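(* Let $n\ge 1$ and let $\lambda=(\lambda_1,\dots,\lambda_n)$ with $\lambda_i>0$ for all $i$. There exist positive constants $A,B$ (depending only on $n$ and $\lambda$) such that for every $f\in\mathcal S(\mathbf R^n)$ whose Fourier transform $\hat f$ is supported in $\mathcal D_0=\{\xi\in\mathbf R^n:\xi_i\ge 0,\ i=1,\dots,n\}$ and every $x\in\mathbf R^n$, $$A\,g^*_{2\lambda}(f)(x)\le h_\lambda(f)(x)\le B\,g^*_{2\lambda}(f)(x),$$ where $2\lambda=(2\lambda_1,\dots,2\lambda_n)$.
   Context: $\mathcal S(\mathbf R^n)$ is the Schwartz space and $\hat f(\xi)=\int_{\mathbf R^n} f(x)e^{-2\pi i x\cdot\xi}\,dx$. For $\beta=(\beta_1,\dots,\beta_n)$, $\beta_i>0$, and $R=(R_1,\dots,R_n)$, $R_i>0$, put $$\tau_R^\beta(f)(x)=\int_{-R_1}^{R_1}\cdots\int_{-R_n}^{R_n}\prod_{i=1}^n\left[\beta_i\frac{|\xi_i|}{R_i}\left(1-\frac{|\xi_i|}{R_i}\right)^{\beta_i-1}\right]\hat f(\xi)e^{2\pi i x\cdot\xi}\,d\xi,$$ $$h_\beta(f)(x)=\left(\int_0^\infty\cdots\int_0^\infty|\tau_R^\beta(f)(x)|^2\,\frac{dR_1}{R_1}\cdots\frac{dR_n}{R_n}\right)^{1/2}.$$ For $\lambda=(\lambda_1,\dots,\lambda_n)$, $\lambda_i>0$, put $$g^*_\lambda(f)(x)=\left(\int_{(\mathbf R\times(0,\infty))^n}\prod_{i=1}^n\left(\frac{t_i}{t_i+|x_i-y_i|}\right)^{\lambda_i}|\nabla_1\cdots\nabla_n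 u(y,t)|^2\,dy\,dt\right)^{1/2},$$ where $u(y,t)=P_t\star f(y)$ is the iterated Poisson integral of $f$, $P_t(x)=\prod_{i=1}^n \frac{t_i}{\pi(x_i^2+t_i^2)}$ for $t=(t_1,\dots,t_n)$, $t_i>0$, and $$|\nabla_1\cdots\nabla_n u(y,t)|^2=\sum_{i_1=0}^1\cdots\sum_{i_n=0}^1\left|\partial^{(1)}_{i_1}\cdots\partial^{(n)}_{i_n}u(y,t)\right|^2,\qquad \partial^{(j)}_0=\partial/\partial t_j,\ \ \partial^{(j)}_1=\partial/\partial y_j.$$ These square functions take values in $[0,\infty]$. *)

theory Defs
  imports "HOL-Analysis.Analysis"
begin

definition dir_deriv :: "'v::real_normed_vector \<Rightarrow> ('v \<Rightarrow> complex) \<Rightarrow> 'v \<Rightarrow> complex" where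
  "dir_deriv v f z = vector_derivative (\<lambda>s::real. f (z + s *\<^sub>R v)) (at 0)"

definition partials :: "'n::finite list \<Rightarrow> (real^'n \<Rightarrow> complex) \<Rightarrow> real^'n \<Rightarrow> complex" where
  "partials js f = foldr (\<lambda>j. dir_deriv (axis j 1)) js f"

definition smooth :: "(real^'n \<Rightarrow> complex) \<Rightarrow> bool" where
  "smooth f \<longleftrightarrow> (\<forall>js. continuous_on UNIV (partials js f) \<and>
     (\<forall>j x. (\<lambda>s::real. partials js f (x + s *\<^sub>R axis j 1)) differentiable (at 0)))"

definition schwartz_space :: "(real^'n \<Rightarrow> complex) set" where
  "schwartz_space = {f. smooth f \<and>
     (\<forall>(\<alpha>::'n \<Rightarrow> nat) js. bounded (range (\<lambda>x. of_real (\<Prod>i\<in>UNIV. (x $ i) ^ \<alpha> i) * partials js f x)))}"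

definition fourier :: "(real^'n \<Rightarrow> complex) \<Rightarrow> real^'n \<Rightarrow> complex" where
  "fourier f \<xi> = (LINT x|lborel. f x * exp (- 2 * of_real pi * \<i> * of_real (x \<bullet> \<xi>)))"

definition D0 :: "(real^'n) set" where
  "D0 = {\<xi>. \<forall>i. 0 \<le> \<xi> $ i}"

definition pos_orthant :: "(real^'n) set" where
  "pos_orthant = {R. \<forall>i. 0 < R $ i}"

text \<open>The set-theoretic integral over the box agrees with the iterated one by Fubini; the
  value \<open>0 powr a = 0\<close> on the faces of the box only concerns a null set.\<close>

definition tau :: "real^'n \<Rightarrow> real^'n \<Rightarrow> (real^'n \<Rightarrow> complex) \<Rightarrow> real^'n \<Rightarrow> complex" where
  "tau \<beta> R f x = (LINT \<xi>:cbox (- R) R|lborel.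
      of_real (\<Prod>i\<in>UNIV. \<beta> $ i * (\<bar>\<xi> $ i\<bar> / R $ i) * (1 - \<bar>\<xi> $ i\<bar> / R $ i) powr (\<beta> $ i - 1))
      * fourier f \<xi> * exp (2 * of_real pi * \<i> * of_real (x \<bullet> \<xi>)))"

definition ennsqrt :: "ennreal \<Rightarrow> ennreal" where
  "ennsqrt a = (if a = \<infinity> then \<infinity> else ennreal (sqrt (enn2real a)))"

definition h_fun :: "real^'n \<Rightarrow> (real^'n \<Rightarrow> complex) \<Rightarrow> real^'n \<Rightarrow> ennreal" where
  "h_fun \<beta> f x = ennsqrt (\<integral>\<^sup>+R\<in>pos_orthant.
      ennreal ((cmod (tau \<beta> R f x))\<^sup>2 / (\<Prod>i\<in>UNIV. R $ i)) \<partial>lborel)"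

definition poisson_kernel :: "real^'n \<Rightarrow> real^'n \<Rightarrow> real" where
  "poisson_kernel t x = (\<Prod>i\<in>UNIV. t $ i / (pi * ((x $ i)\<^sup>2 + (t $ i)\<^sup>2)))"

definition poisson_integral :: "(real^'n \<Rightarrow> complex) \<Rightarrow> (real^'n) \<times> (real^'n) \<Rightarrow> complex" where
  "poisson_integral f = (\<lambda>(y, t). LINT z|lborel. of_real (poisson_kernel t (y - z)) * f z)"

definition half_partial ::
  "nat \<Rightarrow> 'n::finite \<Rightarrow> ((real^'n) \<times> (real^'n) \<Rightarrow> complex) \<Rightarrow> (real^'n) \<times> (real^'n) \<Rightarrow> complex" where
  "half_partial k j = dir_deriv (if k = 0 then (0, axis j 1) else (axis j 1, 0))"

text \<open>The linear order on the index type fixes the order in which the operators attached to the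
  individual coordinates are composed, the one of the smallest index being outermost.\<close>

definition mixed_partial ::
  "('n::{finite,linorder} \<Rightarrow> nat) \<Rightarrow>
    ((real^'n::{finite,linorder}) \<times> (real^'n::{finite,linorder}) \<Rightarrow> complex) \<Rightarrow>
    (real^'n::{finite,linorder}) \<times> (real^'n::{finite,linorder}) \<Rightarrow> complex" where
  "mixed_partial k u = foldr (\<lambda>j. half_partial (k j) j) (sorted_list_of_set UNIV) u"

definition grad_sq ::
  "((real^'n::{finite,linorder}) \<times> (real^'n::{finite,linorder}) \<Rightarrow> complex) \<Rightarrow>
    (real^'n::{finite,linorder}) \<times> (real^'n::{finite,linorder}) \<Rightarrow> real" where
  "grad_sq u p = (\<Sum>k\<in>UNIV \<rightarrow>\<^sub>E {0, 1}. (cmod (mixed_partial k u p))\<^sup>2)"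

definition g_star ::
  "real^'n::{finite,linorder} \<Rightarrow> (real^'n::{finite,linorder} \<Rightarrow> complex) \<Rightarrow> real^'n::{finite,linorder} \<Rightarrow> ennreal" where
  "g_star \<mu> f x = ennsqrt (\<integral>\<^sup>+p\<in>UNIV \<times> pos_orthant.
      (case p of (y, t) \<Rightarrow>
        ennreal ((\<Prod>i\<in>UNIV. (t $ i / (t $ i + \<bar>x $ i - y $ i\<bar>)) powr (\<mu> $ i))
          * grad_sq (poisson_integral f) (y, t))) \<partial>lborel)"

end

theory Submission
  imports Defs "HOL-Complex_Analysis.Conformal_Mappings"
begin

text \<open>
  Since the spectrum of \<open>f\<close> lies in the positive orthant, all \<open>2^n\<close> mixed derivatives of the Poisson
  integral have the same modulus, \<open>(2 \<pi>)^n\<close> times that of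
  \<open>G(y, t) = \<integral> \<xi>\<^sub>1 \<dots> \<xi>\<^sub>n F(\<xi>) e^(2 \<pi> i y\<cdot>\<xi> - 2 \<pi> t\<cdot>\<xi>) d\<xi>\<close>, where \<open>F\<close> is the Fourier transform of \<open>f\<close>.
  Up to constants the weight \<open>(t / (t + \<bar>x - y\<bar>))^(2 \<lambda>)\<close> is \<open>t^(2 \<lambda>) \<bar>t + i (x - y)\<bar>^(-2 \<lambda>)\<close>, and
  \<open>(t + i \<eta>)^(-\<lambda>)\<close> is a multiple of the Fourier transform of \<open>s^(\<lambda> - 1) e^(-2 \<pi> t s)\<close> on \<open>s > 0\<close>.
  Hence for fixed \<open>t\<close> the weighted function is the Fourier transform of a convolution, whose value at \<open>R\<close>
  is \<open>e^(-2 \<pi> t\<cdot>R) \<Prod> R\<^sub>i^(\<lambda>\<^sub>i) / \<lambda>\<^sub>i\<close> times the Riesz mean \<open>\<tau>\<close> of \<open>f\<close> at \<open>x\<close>. Plancherel in \<open>y\<close> and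
  integration of \<open>t^(2 \<lambda>) e^(-4 \<pi> t\<cdot>R)\<close> in \<open>t\<close> turn the weighted integral into a
  constant multiple of the square of \<open>h\<close>.
\<close>

section \<open>Product integrals and Laplace transforms of powers\<close>

text \<open>The exponents fit for one reason. Squaring a kernel of exponent \<open>\<lambda>\<close>
  gives the weight of exponent \<open>2 \<lambda>\<close>, and convolving that kernel with
  \<open>\<xi>_1 ... \<xi>_n F\<close> gives a Riesz mean of the same order
  \<open>\<lambda>\<close>. The \<open>t\<close> integral then yields
  \<open>R^(-2 \<lambda> - 1)\<close>, which against the squared factor
  \<open>R^(2 \<lambda>)\<close> leaves exactly \<open>1 / R\<close>, the density in the definition
  of \<open>h_fun\<close>. The obstacle is that \<open>s^(\<lambda> - 1)\<close> is unbounded near 0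
  when \<open>\<lambda> < 1\<close>, so the kernel is handled only as an integrable function.
  Boundedness and continuity of the convolution, on which Plancherel rests, come from the other
  factor. The final integrals may be infinite, so all identities between them are read in
  \<open>[0, infinity]\<close> and the order of integration is changed by Tonelli. Everything up to
  the last comparison is an equality. The only loss is in replacing \<open>t + \<bar>d\<bar>\<close>
  by the modulus of \<open>t + i d\<close>, which is why the two constants obtained differ just by
  the factor \<open>2^((\<lambda>_1 + ... + \<lambda>_n) / 2)\<close>.\<close>

lemma measurable_vec_lambda_PiM [measurable]:
  "(\<lambda>f. \<chi> i. f i) \<in> (\<Pi>\<^sub>M i\<in>(UNIV::'n set). lborel) \<rightarrow>\<^sub>M (borel :: (real^'n) measure)"
proof (rule borel_measurable_euclidean_space[THEN iffD2], rule ballI)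
  fix b :: "real^'n" assume "b \<in> Basis"
  then obtain i where b: "b = axis i 1" by (auto simp: Basis_vec_def)
  show "(\<lambda>f. (\<chi> i. f i) \<bullet> b) \<in> borel_measurable (\<Pi>\<^sub>M i\<in>UNIV. lborel)"
    unfolding b by (simp add: cart_eq_inner_axis[symmetric])
qed

text \<open>Both measures give an open box the product of its side lengths, which characterises
  Lebesgue measure. Integrals of products of one-variable functions over \<open>real^'n\<close>
  thereby factor into one-dimensional ones.\<close>

lemma lborel_vec:
  "(lborel :: (real^'n) measure) = distr (\<Pi>\<^sub>M i\<in>UNIV. lborel) borel (\<lambda>f. \<chi> i. f i)"
proof (rule lborel_eqI)
  interpret product_sigma_finite "\<lambda>_::'n. lborel :: real measure" ..
  fix l u :: "real^'n"
  assume le: "\<And>b. b \<in> Basis \<Longrightarrow> l \<bullet> b \<le> u \<bullet> b"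
  have le': "l $ i \<le> u $ i" for i
    using le[of "axis i 1"] by (simp add: cart_eq_inner_axis)
  have eq: "(\<lambda>f. \<chi> i. f i) -` box l u \<inter> space (\<Pi>\<^sub>M i\<in>UNIV. lborel) = (\<Pi>\<^sub>E i\<in>UNIV. {l $ i<..<u $ i})"
    by (auto simp: mem_box_cart space_PiM PiE_def Pi_def)
  have "emeasure (distr (\<Pi>\<^sub>M i\<in>UNIV. lborel) borel (\<lambda>f. \<chi> i. f i)) (box l u)
      = (\<Prod>i\<in>UNIV. emeasure lborel {l $ i<..<u $ i})"
    by (subst emeasure_distr) (auto simp: eq emeasure_PiM)
  also have "\<dots> = ennreal (\<Prod>i\<in>UNIV. (u - l) $ i)"
    using le' by (simp add: prod_ennreal)
  also have "(\<Prod>i\<in>UNIV. (u - l) $ i) = (\<Prod>b\<in>Basis. (u - l) \<bullet> b)"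
  proof (rule prod.reindex_cong[symmetric])
    show "inj_on (\<lambda>i::'n. axis i (1::real)) UNIV" by (auto simp: inj_on_def axis_eq_axis)
    show "(Basis :: (real^'n) set) = range (\<lambda>i. axis i 1)" by (auto simp: Basis_vec_def)
  qed (simp add: cart_eq_inner_axis)
  finally show "emeasure (distr (\<Pi>\<^sub>M i\<in>UNIV. lborel) borel (\<lambda>f. \<chi> i. f i)) (box l u)
      = (\<Prod>b\<in>Basis. (u - l) \<bullet> b)" .
qed simp

lemma measurable_vec_component [measurable]: "(\<lambda>x::real^'n. x $ i) \<in> borel_measurable borel"
  by (intro borel_measurable_continuous_onI continuous_intros)

lemma has_bochner_integral_prod_vec:
  fixes f :: "'n::finite \<Rightarrow> real \<Rightarrow> 'a::{real_normed_field,banach,second_countable_topology}"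
  assumes "\<And>i. has_bochner_integral lborel (f i) (I i)"
  shows "has_bochner_integral lborel (\<lambda>x::real^'n. \<Prod>i\<in>UNIV. f i (x $ i)) (\<Prod>i\<in>UNIV. I i)"
proof -
  interpret product_sigma_finite "\<lambda>_::'n. lborel :: real measure" ..
  have int: "integrable lborel (f i)" for i using assms by (simp add: has_bochner_integral_iff)
  have [measurable]: "f i \<in> borel_measurable borel" for i using int[of i] by auto
  have "(LINT x|lborel. f i x) = I i" for i using assms by (simp add: has_bochner_integral_iff)
  then show ?thesis
    using product_integrable_prod[of UNIV f] product_integral_prod[of UNIV f] int
    unfolding has_bochner_integral_iff
    by (subst lborel_vec, subst integrable_distr_eq, simp, simp)
       (subst lborel_vec, subst integral_distr, auto)
qed

lemma nn_integral_prod_vec: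
  fixes f :: "'n::finite \<Rightarrow> real \<Rightarrow> ennreal"
  assumes [measurable]: "\<And>i. f i \<in> borel_measurable borel"
  shows "(\<integral>\<^sup>+x. (\<Prod>i\<in>UNIV. f i (x $ i)) \<partial>(lborel :: (real^'n) measure)) = (\<Prod>i\<in>UNIV. \<integral>\<^sup>+s. f i s \<partial>lborel)"
proof -
  interpret product_sigma_finite "\<lambda>_::'n. lborel :: real measure" ..
  show ?thesis
    using product_nn_integral_prod[of UNIV f]
    by (subst lborel_vec, subst nn_integral_distr) auto
qed

section \<open>Differentiation under the integral of an exponential\<close>

text \<open>An exponential moment of order \<open>d\<close> dominates the second-order Taylor
  remainder uniformly for \<open>norm h \<le> d / 2\<close>, so the difference quotient has error
  \<open>O(norm h)\<close>. The parameter \<open>h\<close> is complex: the lemma gives holomorphy of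
  Laplace transforms and, restricted to real \<open>h\<close>, directional derivatives.\<close>

lemma has_field_derivative_integral_exp:
  fixes w a :: "'a \<Rightarrow> complex"
  assumes [measurable]: "w \<in> borel_measurable M" "a \<in> borel_measurable M"
    and d: "d > 0" and int: "integrable M (\<lambda>x. norm (w x) * exp (d * norm (a x)))"
  shows "((\<lambda>h. \<integral>x. w x * exp (h * a x) \<partial>M) has_field_derivative (\<integral>x. w x * a x \<partial>M)) (at 0)"
proof -
  define C where "C = (\<integral>x. norm (w x) * exp (d * norm (a x)) \<partial>M)"
  have C0: "C \<ge> 0" unfolding C_def by simp
  have int_h: "integrable M (\<lambda>x. w x * exp (h * a x))" if "norm h \<le> d" for h
  proof (rule Bochner_Integration.integrable_bound[OF int])
    show "AE x in M. norm (w x * exp (h * a x)) \<le> norm (norm (w x) * exp (d * norm (a x)))"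
    proof (rule AE_I2)
      fix x
      have "norm (exp (h * a x)) \<le> exp (norm (h * a x))" by (rule norm_exp)
      also have "\<dots> \<le> exp (d * norm (a x))" using that by (simp add: norm_mult mult_right_mono)
      finally show "norm (w x * exp (h * a x)) \<le> norm (norm (w x) * exp (d * norm (a x)))"
        by (simp add: norm_mult mult_left_mono)
    qed
  qed measurable
  have int_a: "integrable M (\<lambda>x. w x * a x)"
  proof (rule Bochner_Integration.integrable_bound)
    show "integrable M (\<lambda>x. (norm (w x) * exp (d * norm (a x))) / d)" using int by simp
    show "AE x in M. norm (w x * a x) \<le> norm ((norm (w x) * exp (d * norm (a x))) / d)"
    proof (rule AE_I2)
      fix x
      have "d * norm (a x) \<le> exp (d * norm (a x))" using exp_ge_add_one_self[of "d * norm (a x)"] by linarith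
      then have "norm (w x) * (d * norm (a x)) \<le> norm (w x) * exp (d * norm (a x))" by (intro mult_left_mono) auto
      then show "norm (w x * a x) \<le> norm ((norm (w x) * exp (d * norm (a x))) / d)"
        using d by (simp add: norm_mult field_simps)
    qed
  qed measurable
  have bnd: "norm ((\<integral>x. w x * exp (h * a x) \<partial>M) - (\<integral>x. w x * exp (0 * a x) \<partial>M) - (\<integral>x. w x * a x \<partial>M) * h)
      \<le> (norm h)\<^sup>2 * (8 * C / d\<^sup>2)" if h: "norm h \<le> d / 2" for h
  proof -
    have hd: "norm h \<le> d" "norm (0::complex) \<le> d" using h d by auto
    have "(\<integral>x. w x * exp (h * a x) \<partial>M) - (\<integral>x. w x * exp (0 * a x) \<partial>M) - (\<integral>x. w x * a x \<partial>M) * h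
       = (\<integral>x. w x * exp (h * a x) - w x * exp (0 * a x) - (w x * a x) * h \<partial>M)"
      using int_h[OF hd(1)] int_h[OF hd(2)] int_a by simp
    also have "norm \<dots> \<le> (\<integral>x. (norm (w x) * exp (d * norm (a x))) * ((norm h)\<^sup>2 * (8 / d\<^sup>2)) \<partial>M)"
    proof (rule order_trans[OF Bochner_Integration.integral_norm_bound Bochner_Integration.integral_mono])
      show "integrable M (\<lambda>x. norm (w x * exp (h * a x) - w x * exp (0 * a x) - w x * a x * h))"
        using int_h[OF hd(1)] int_h[OF hd(2)] int_a by simp
      show "integrable M (\<lambda>x. norm (w x) * exp (d * norm (a x)) * ((norm h)\<^sup>2 * (8 / d\<^sup>2)))"
        using int by simp
      fix x
      define z where "z = h * a x"
      \<comment> \<open>The available exponential \<open>exp (d * norm (a x))\<close> is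
        \<open>exp r * exp r\<close>. One factor bounds \<open>exp \<bar>Re z\<bar>\<close>, the
        other absorbs \<open>r\<^sup>2 / 2\<close>; writing \<open>norm z\<close> through
        \<open>r\<close> costs \<open>4 / d\<^sup>2\<close>, whence the constant
        \<open>8 / d\<^sup>2\<close>.\<close>
      define r where "r = d * norm (a x) / 2"
      have r0: "r \<ge> 0" using d by (simp add: r_def)
      have zr: "norm z \<le> norm h * (2 * r / d)" "norm z \<le> r"
        using h d mult_right_mono[OF h, of "norm (a x)"] by (auto simp: z_def r_def norm_mult field_simps)
      have "norm (exp z - (\<Sum>k\<le>1. z ^ k / fact k)) \<le> exp \<bar>Re z\<bar> * norm z ^ Suc 1 / fact 1"
        by (rule Taylor_exp)
      then have "norm (exp z - 1 - z) \<le> exp \<bar>Re z\<bar> * (norm z)\<^sup>2"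
        by (simp add: power2_eq_square algebra_simps)
      also have "\<dots> \<le> exp r * (norm h * (2 * r / d))\<^sup>2"
        using zr abs_Re_le_cmod[of z] by (intro mult_mono power_mono) auto
      also have "\<dots> = (exp r * r\<^sup>2 / 2) * ((norm h)\<^sup>2 * (8 / d\<^sup>2))"
        by (simp add: power2_eq_square field_simps)
      also have "\<dots> \<le> (exp r * exp r) * ((norm h)\<^sup>2 * (8 / d\<^sup>2))"
        using exp_lower_Taylor_quadratic[OF r0] r0 
        by (intro mult_right_mono) auto
      also have "exp r * exp r = exp (d * norm (a x))" by (simp add: r_def flip: exp_add)
      finally have "norm (w x) * norm (exp z - 1 - z) \<le> norm (w x) * (exp (d * norm (a x)) * ((norm h)\<^sup>2 * (8 / d\<^sup>2)))"
        by (intro mult_left_mono) auto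
      moreover have "w x * exp (h * a x) - w x * exp (0 * a x) - w x * a x * h = w x * (exp z - 1 - z)"
        by (simp add: z_def algebra_simps)
      ultimately show "norm (w x * exp (h * a x) - w x * exp (0 * a x) - w x * a x * h)
          \<le> norm (w x) * exp (d * norm (a x)) * ((norm h)\<^sup>2 * (8 / d\<^sup>2))"
        by (simp add: norm_mult mult_ac)
    qed
    also have "\<dots> = (norm h)\<^sup>2 * (8 * C / d\<^sup>2)" by (simp add: C_def)
    finally show ?thesis .
  qed
  show ?thesis
    unfolding has_field_derivative_def has_derivative_iff_norm
  proof (intro conjI)
    show "bounded_linear ((*) (\<integral>x. w x * a x \<partial>M))" by (rule bounded_linear_mult_right)
    have "((\<lambda>h::complex. norm h * (8 * C / d\<^sup>2)) \<longlongrightarrow> norm (0::complex) * (8 * C / d\<^sup>2)) (at 0)"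
      by (intro tendsto_intros)
    then have lim: "((\<lambda>h::complex. norm h * (8 * C / d\<^sup>2)) \<longlongrightarrow> 0) (at 0)" by simp
    have "\<forall>\<^sub>F h in at (0::complex). norm h \<le> d / 2"
      unfolding eventually_at using d by (intro exI[of _ "d/2"]) auto
    then have ev: "\<forall>\<^sub>F h in at (0::complex). norm (norm ((\<integral>x. w x * exp (h * a x) \<partial>M) - (\<integral>x. w x * exp (0 * a x) \<partial>M)
        - (\<integral>x. w x * a x \<partial>M) * (h - 0)) / norm (h - 0)) \<le> norm h * (8 * C / d\<^sup>2)"
    proof eventually_elim
      case (elim h)
      show ?case
      proof (cases "h = 0")
        case False
        then show ?thesis using bnd[OF elim] by (simp add: field_simps power2_eq_square)
      qed simp
    qed
    show "((\<lambda>h. norm ((\<integral>x. w x * exp (h * a x) \<partial>M) - (\<integral>x. w x * exp (0 * a x) \<partial>M)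
        - (\<integral>x. w x * a x \<partial>M) * (h - 0)) / norm (h - 0)) \<longlongrightarrow> 0) (at 0)"
      by (rule Lim_null_comparison[OF ev lim])
  qed
qed

text \<open>The Riemann-Liouville kernel of fractional integration of order \<open>l\<close>,
  without its factor \<open>1 / Gamma l\<close>. It is zero at \<open>s = 0\<close> for every
  \<open>l\<close>.\<close>

definition lap_kernel :: "real \<Rightarrow> real \<Rightarrow> real" where
  "lap_kernel l s = indicator {0<..} s * s powr (l - 1)"

lemma lap_kernel_measurable [measurable]: "lap_kernel l \<in> borel_measurable borel"
  unfolding lap_kernel_def by measurable

lemma lap_kernel_nonneg: "0 \<le> lap_kernel l s"
  by (simp add: lap_kernel_def)

lemma nn_integral_lap_kernel:
  assumes l: "l > 0" and a: "a > 0"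
  shows "(\<integral>\<^sup>+s. ennreal (lap_kernel l s * exp (- a * s)) \<partial>lborel) = ennreal (Gamma l / a powr l)"
proof -
  have "ennreal (Gamma l) = (\<integral>\<^sup>+t. ennreal (indicator {0..} t * t powr (l - 1) / exp t) \<partial>lborel)"
    using Gamma_conv_nn_integral_real[OF l] .
  also have "\<dots> = (\<integral>\<^sup>+t. ennreal (lap_kernel l t * exp (- t)) \<partial>lborel)"
    by (intro nn_integral_cong) (auto simp: lap_kernel_def indicator_def exp_minus field_simps)
  also have "\<dots> = ennreal a * (\<integral>\<^sup>+s. ennreal (lap_kernel l (a * s) * exp (- (a * s))) \<partial>lborel)"
    using a by (subst nn_integral_real_affine[where c = a and t = 0]) auto
  also have "\<dots> = (\<integral>\<^sup>+s. ennreal (a powr l) * ennreal (lap_kernel l s * exp (- a * s)) \<partial>lborel)"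
    using a
    by (subst nn_integral_cmult[symmetric])
       (auto simp: lap_kernel_def indicator_def powr_mult powr_diff zero_less_mult_iff
          ennreal_mult[symmetric] intro!: nn_integral_cong)
  also have "\<dots> = ennreal (a powr l) * (\<integral>\<^sup>+s. ennreal (lap_kernel l s * exp (- a * s)) \<partial>lborel)"
    by (rule nn_integral_cmult) measurable
  finally have "ennreal (a powr l) * (\<integral>\<^sup>+s. ennreal (lap_kernel l s * exp (- a * s)) \<partial>lborel) = ennreal (Gamma l)" ..
  then have "ennreal (1 / a powr l) * (ennreal (a powr l) * (\<integral>\<^sup>+s. ennreal (lap_kernel l s * exp (- a * s)) \<partial>lborel))
      = ennreal (1 / a powr l) * ennreal (Gamma l)" by simp
  then show ?thesis using a l Gamma_real_pos[OF l]
    by (simp add: mult.assoc[symmetric] ennreal_mult[symmetric])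
qed

lemma has_bochner_integral_lap_kernel_real:
  assumes l: "l > 0" and a: "a > 0"
  shows "has_bochner_integral lborel (\<lambda>s. lap_kernel l s * exp (- a * s)) (Gamma l / a powr l)"
  using nn_integral_lap_kernel[OF assms] Gamma_real_pos[OF l]
  by (intro has_bochner_integral_nn_integral) (auto simp: lap_kernel_nonneg)

lemma integrable_lap_kernel_complex:
  assumes l: "l > 0" and w: "Re w > 0"
  shows "integrable lborel (\<lambda>s. of_real (lap_kernel l s) * exp (- w * of_real s))"
proof (rule Bochner_Integration.integrable_bound)
  show "integrable lborel (\<lambda>s. lap_kernel l s * exp (- Re w * s))"
    using has_bochner_integral_lap_kernel_real[OF l w] by (simp add: has_bochner_integral_iff)
  show "AE s in lborel. norm (of_real (lap_kernel l s) * exp (- w * of_real s)) \<le> norm (lap_kernel l s * exp (- Re w * s))"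
    by (auto simp: norm_mult lap_kernel_nonneg)
qed measurable

text \<open>On the positive reals this is the scaled Gamma integral. Both sides are holomorphic on
  the right half-plane, where the principal branch of the power has no cut, so the identity theorem
  extends the formula.\<close>

lemma has_bochner_integral_lap_kernel:
  assumes l: "l > 0" and w: "Re w > 0"
  shows "has_bochner_integral lborel (\<lambda>s. of_real (lap_kernel l s) * exp (- w * of_real s)) (of_real (Gamma l) * w powr (- of_real l))"
proof -
  define F :: "complex \<Rightarrow> complex" where "F = (\<lambda>w. LINT s|lborel. of_real (lap_kernel l s) * exp (- w * of_real s))"
  have "(F has_field_derivative (LINT s|lborel. (of_real (lap_kernel l s) * exp (- w * of_real s)) * (- of_real s))) (at w)"
    if "Re w > 0" for w
  proof -
    have "((\<lambda>h. LINT s|lborel. (of_real (lap_kernel l s) * exp (- w * of_real s)) * exp (h * (- of_real s)))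
      has_field_derivative (LINT s|lborel. (of_real (lap_kernel l s) * exp (- w * of_real s)) * (- of_real s))) (at 0)"
    \<comment> \<open>Half of the decay rate \<open>Re w\<close> pays for the exponential moment;
      the other half keeps the integral convergent.\<close>
    proof (rule has_field_derivative_integral_exp[where d = "Re w / 2"])
      have "integrable lborel (\<lambda>s. lap_kernel l s * exp (- (Re w / 2) * s))"
        using has_bochner_integral_lap_kernel_real[OF l, of "Re w / 2"] that
        by (simp add: has_bochner_integral_iff)
      also have "?this \<longleftrightarrow> integrable lborel (\<lambda>s. norm (of_real (lap_kernel l s) * exp (- w * of_real s))
          * exp (Re w / 2 * norm (- complex_of_real s)))"
        by (intro Bochner_Integration.integrable_cong refl)
           (auto simp: norm_mult lap_kernel_def indicator_def simp flip: exp_add)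
      finally show "integrable lborel (\<lambda>s. norm (of_real (lap_kernel l s) * exp (- w * of_real s))
          * exp (Re w / 2 * norm (- complex_of_real s)))" .
    qed (use that in auto)
    then have "((\<lambda>h. F (h + w)) has_field_derivative (LINT s|lborel. (of_real (lap_kernel l s) * exp (- w * of_real s)) * (- of_real s))) (at 0)"
      by (simp add: F_def mult.assoc algebra_simps flip: exp_add)
    then show ?thesis using DERIV_at_within_shift[of F _ w 0 UNIV] by (simp add: add.commute)
  qed
  then have hol: "F holomorphic_on {w. Re w > 0}"
    by (auto simp: holomorphic_on_def field_differentiable_def intro: has_field_derivative_at_within)
  have "F w - of_real (Gamma l) * w powr (- of_real l) = 0"
  proof (rule analytic_continuation[where f = "\<lambda>w. F w - of_real (Gamma l) * w powr (- of_real l)" and w = w and S = "{w. Re w > 0}" and U = "of_real ` {0<..}" and \<xi> = 1])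
    show "(\<lambda>w. F w - of_real (Gamma l) * w powr (- of_real l)) holomorphic_on {w. Re w > 0}"
      by (intro holomorphic_intros hol) (auto simp: complex_nonpos_Reals_iff)
    show "open {w. Re w > 0}" by (rule open_halfspace_Re_gt)
    show "connected {w. Re w > 0}" by (intro convex_connected convex_halfspace_Re_gt)
    show "(1::complex) islimpt of_real ` {0<..}"
    proof (rule islimptI)
      fix U :: "complex set" assume "1 \<in> U" "open U"
      then obtain e where e: "e > 0" "ball 1 e \<subseteq> U" by (auto simp: open_contains_ball)
      then have "of_real (1 + e/2) \<in> ball (1::complex) e" by (simp add: dist_norm)
      with e show "\<exists>y\<in>of_real ` {0<..}. y \<in> U \<and> y \<noteq> (1::complex)"
        by (intro bexI[of _ "of_real (1 + e/2)"]) (auto simp: of_real_eq_1_iff simp del: of_real_add)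
    qed
    fix z :: complex assume "z \<in> of_real ` {0<..}"
    then obtain a where a: "a > 0" "z = of_real a" by auto
    have "F z = (LINT s|lborel. of_real (lap_kernel l s * exp (- a * s)))"
      by (simp add: F_def a exp_of_real[symmetric])
    also have "\<dots> = of_real (LINT s|lborel. lap_kernel l s * exp (- a * s))" by (rule integral_complex_of_real)
    also have "\<dots> = of_real (Gamma l / a powr l)"
      using has_bochner_integral_lap_kernel_real[OF l a(1)] by (simp add: has_bochner_integral_iff)
    finally show "F z - of_real (Gamma l) * z powr (- of_real l) = 0"
      using a by (simp add: powr_of_real[symmetric] powr_minus divide_inverse)
  qed (use w in auto)
  then show ?thesis using integrable_lap_kernel_complex[OF assms]
    by (simp add: has_bochner_integral_iff F_def)
qed

section \<open>Fourier transform and Poisson integral\<close>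

lemma norm_exp_imaginary [simp]:
  "cmod (exp (- 2 * of_real pi * \<i> * of_real r)) = 1" "cmod (exp (2 * of_real pi * \<i> * of_real r)) = 1"
  "cmod (exp (- (2 * of_real pi * \<i> * of_real r))) = 1"
  by (simp_all add: norm_exp_eq_Re)

lemma continuous_on_lebesgue_integral:
  fixes F :: "'b::{first_countable_topology,t2_space} \<Rightarrow> 'a \<Rightarrow> 'c::{banach,second_countable_topology}"
  assumes meas [measurable]: "\<And>x. F x \<in> borel_measurable M" and g: "integrable M g"
    and cont: "\<And>a. continuous_on UNIV (\<lambda>x. F x a)" and bnd: "\<And>x a. norm (F x a) \<le> g a"
  shows "continuous_on UNIV (\<lambda>x. \<integral>a. F x a \<partial>M)"
proof (intro continuous_at_imp_continuous_on ballI continuous_at_sequentiallyI)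
  fix x and u :: "nat \<Rightarrow> 'b" assume u: "u \<longlonglongrightarrow> x"
  show "(\<lambda>n. \<integral>a. F (u n) a \<partial>M) \<longlonglongrightarrow> (\<integral>a. F x a \<partial>M)"
  proof (rule integral_dominated_convergence[where w = g])
    show "AE a in M. (\<lambda>n. F (u n) a) \<longlonglongrightarrow> F x a"
      using cont u by (intro AE_I2 continuous_on_tendsto_compose[OF cont]) auto
  qed (use g bnd in auto)
qed

lemma
  fixes f :: "'a::euclidean_space \<Rightarrow> 'b::{banach,second_countable_topology}"
  assumes [measurable]: "f \<in> borel_measurable borel" and c: "c \<noteq> 0"
  shows integral_affine_euclidean:
      "(\<integral>x. f x \<partial>lborel) = \<bar>c\<bar> ^ DIM('a) *\<^sub>R (\<integral>x. f (t + c *\<^sub>R x) \<partial>lborel)"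
    and integrable_affine_euclidean:
      "integrable lborel f \<longleftrightarrow> integrable lborel (\<lambda>x. f (t + c *\<^sub>R x))"
proof -
  have [simp]: "ennreal \<bar>c\<bar> ^ DIM('a) = ennreal (\<bar>c\<bar> ^ DIM('a))" by (simp add: ennreal_power)
  show "(\<integral>x. f x \<partial>lborel) = \<bar>c\<bar> ^ DIM('a) *\<^sub>R (\<integral>x. f (t + c *\<^sub>R x) \<partial>lborel)"
    by (subst lborel_affine[OF c, of t]) (simp add: integral_density integral_distr)
  define d where "d = \<bar>c\<bar> ^ DIM('a)"
  have d: "d \<noteq> 0" using c by (simp add: d_def)
  have "integrable lborel f \<longleftrightarrow> integrable lborel (\<lambda>x. d *\<^sub>R f (t + c *\<^sub>R x))"
    by (subst lborel_affine[OF c, of t]) (simp add: integrable_density integrable_distr_eq d_def)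
  also have "\<dots> \<longleftrightarrow> integrable lborel (\<lambda>x. f (t + c *\<^sub>R x))"
    using d integrable_scaleR_right[of "1/d" lborel "\<lambda>x. d *\<^sub>R f (t + c *\<^sub>R x)"] by auto
  finally show "integrable lborel f \<longleftrightarrow> integrable lborel (\<lambda>x. f (t + c *\<^sub>R x))" .
qed

lemma
  fixes f :: "'a::euclidean_space \<Rightarrow> 'b::{banach,second_countable_topology}"
  assumes f: "integrable lborel f"
  shows integral_shift: "(\<integral>x. f (x - t) \<partial>lborel) = (\<integral>x. f x \<partial>lborel)"
    and integrable_shift: "integrable lborel (\<lambda>x. f (x - t))"
  using f integral_affine_euclidean[of f 1 "-t"] integrable_affine_euclidean[of f 1 "-t"]
  by (auto dest: borel_measurable_integrable)

lemma integrable_pair_mult: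
  fixes f :: "'a \<Rightarrow> complex" and g :: "'b \<Rightarrow> complex"
  assumes "sigma_finite_measure M" "sigma_finite_measure N" and f: "integrable M f" and g: "integrable N g"
  shows "integrable (M \<Otimes>\<^sub>M N) (\<lambda>(x, y). f x * g y)"
proof -
  interpret pair_sigma_finite M N using assms by (simp add: pair_sigma_finite_def)
  have [measurable]: "f \<in> borel_measurable M" "g \<in> borel_measurable N" using f g by auto
  show ?thesis
    using f g by (intro Fubini_integrable) (auto simp: norm_mult)
qed

lemma fourier_norm_le: "cmod (fourier f \<xi>) \<le> (\<integral>x. cmod (f x) \<partial>lborel)"
  unfolding fourier_def by (rule order_trans[OF Bochner_Integration.integral_norm_bound]) (simp add: norm_mult)

lemma continuous_on_fourier:
  assumes f: "integrable lborel f"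
  shows "continuous_on UNIV (fourier f)"
proof -
  have [measurable]: "f \<in> borel_measurable borel" using f by auto
  show ?thesis unfolding fourier_def
  proof (rule continuous_on_lebesgue_integral[where g = "\<lambda>x. cmod (f x)"])
    show "continuous_on UNIV (\<lambda>\<xi>. f x * exp (- 2 * of_real pi * \<i> * of_real (x \<bullet> \<xi>)))" for x
      by (intro continuous_intros)
  qed (use f in \<open>auto simp: norm_mult\<close>)
qed

lemma fourier_measurable:
  assumes "integrable lborel f"
  shows "fourier f \<in> borel_measurable borel"
  by (intro borel_measurable_continuous_onI continuous_on_fourier assms)

text \<open>Fubini for the symmetric unimodular kernel, with majorant
  \<open>\<bar>f x\<bar> \<bar>g \<xi>\<bar>\<close>. It replaces Fourier inversion throughout: it
  identifies the Poisson integral as a Fourier multiplier and it starts the proof of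
  Plancherel.\<close>

lemma fourier_multiplication:
  fixes f g :: "real^'n \<Rightarrow> complex"
  assumes f: "integrable lborel f" and g: "integrable lborel g"
  shows "(\<integral>\<xi>. fourier f \<xi> * g \<xi> \<partial>lborel) = (\<integral>x. f x * fourier g x \<partial>lborel)"
proof -
  have [measurable]: "f \<in> borel_measurable borel" "g \<in> borel_measurable borel" using f g by auto
  let ?e = "\<lambda>x \<xi>. exp (- 2 * of_real pi * \<i> * of_real (x \<bullet> \<xi>)) :: complex"
  have int: "integrable (lborel \<Otimes>\<^sub>M lborel) (\<lambda>(x, \<xi>). f x * g \<xi> * ?e x \<xi>)"
  proof (rule Bochner_Integration.integrable_bound)
    show "integrable (lborel \<Otimes>\<^sub>M lborel) (\<lambda>(x, \<xi>). f x * g \<xi>)"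
      by (intro integrable_pair_mult f g sigma_finite_lborel)
  qed (auto simp: norm_mult)
  have "(\<integral>\<xi>. fourier f \<xi> * g \<xi> \<partial>lborel) = (\<integral>\<xi>. (\<integral>x. f x * g \<xi> * ?e x \<xi> \<partial>lborel) \<partial>lborel)"
    by (simp add: fourier_def mult_ac flip: integral_mult_right_zero integral_mult_left_zero)
  also have "\<dots> = (\<integral>x. (\<integral>\<xi>. f x * g \<xi> * ?e x \<xi> \<partial>lborel) \<partial>lborel)"
    by (rule lborel_pair.Fubini_integral[OF int])
  also have "\<dots> = (\<integral>x. f x * fourier g x \<partial>lborel)"
    by (simp add: fourier_def mult.assoc inner_commute)
  finally show ?thesis .
qed

section \<open>The Poisson kernel and its exponential multiplier\<close>

text \<open>Each half-line contributes a Laplace transform of the constant 1, at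
  \<open>w v = 2 \<pi> (t - i v)\<close> and at its conjugate \<open>w (- v)\<close>. The two
  reciprocals have sum \<open>4 \<pi> t\<close> over product
  \<open>4 \<pi>^2 (v^2 + t^2)\<close>.\<close>

lemma has_bochner_integral_exp_abs:
  assumes t: "t > 0"
  shows "has_bochner_integral lborel (\<lambda>s. exp (of_real (- 2 * pi * t * \<bar>s\<bar>) + 2 * of_real pi * \<i> * of_real (v * s)))
    (of_real (t / (pi * (v\<^sup>2 + t\<^sup>2))))"
proof -
  define w where "w v = Complex (2 * pi * t) (- (2 * pi * v))" for v
  have h: "has_bochner_integral lborel (\<lambda>s. of_real (lap_kernel 1 s) * exp (- w v * of_real s)) (1 / w v)" for v
  proof -
    have "Re (w v) > 0" using t by (simp add: w_def)
    then have "w v \<noteq> 0" by auto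
    then have "of_real (Gamma (1::real)) * w v powr (- of_real 1) = 1 / w v"
      by (simp add: powr_minus divide_inverse)
    with has_bochner_integral_lap_kernel[of 1 "w v"] \<open>Re (w v) > 0\<close> show ?thesis by simp
  qed
  have "has_bochner_integral lborel (\<lambda>s. of_real (lap_kernel 1 (0 + (-1) * s)) * exp (- w (- v) * of_real (0 + (-1) * s)))
      (1 / w (- v) /\<^sub>R \<bar>-1\<bar>)"
    using lborel_has_bochner_integral_real_affine_iff[of "-1" "\<lambda>s. of_real (lap_kernel 1 s) * exp (- w (-v) * of_real s)" "1 / w (-v)" 0] h[of "- v"]
    by simp
  then have "has_bochner_integral lborel (\<lambda>s. of_real (lap_kernel 1 s) * exp (- w v * of_real s) +
      of_real (lap_kernel 1 (- s)) * exp (w (- v) * of_real s)) (1 / w v + 1 / w (- v))"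
    by (intro has_bochner_integral_add h) simp
  also have "?this \<longleftrightarrow> has_bochner_integral lborel
      (\<lambda>s. exp (of_real (- 2 * pi * t * \<bar>s\<bar>) + 2 * of_real pi * \<i> * of_real (v * s))) (1 / w v + 1 / w (- v))"
  \<comment> \<open>Both one-sided kernels vanish at 0 while the two-sided exponential is 1 there,
    so the point 0 has to be discarded.\<close>
  proof (rule has_bochner_integral_discrete_difference[where X = "{0}"])
    fix s :: real assume "s \<notin> {0}"
    then show "of_real (lap_kernel 1 s) * exp (- w v * of_real s) +
      of_real (lap_kernel 1 (- s)) * exp (w (- v) * of_real s)
      = exp (of_real (- 2 * pi * t * \<bar>s\<bar>) + 2 * of_real pi * \<i> * of_real (v * s))"
      by (cases "s > 0") (auto simp: lap_kernel_def w_def complex_eq_iff exp_eq_polar Re_exp Im_exp algebra_simps)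
  qed auto
  also have "1 / w v + 1 / w (- v) = of_real (t / (pi * (v\<^sup>2 + t\<^sup>2)))"
  proof -
    have "v\<^sup>2 + t\<^sup>2 \<noteq> 0" "w v \<noteq> 0" "w (- v) \<noteq> 0" using t by (auto simp: w_def complex_eq_iff add_nonneg_eq_0_iff)
    moreover have "w v * w (- v) = of_real (4 * pi\<^sup>2 * (v\<^sup>2 + t\<^sup>2))" "w v + w (- v) = of_real (4 * pi * t)"
      by (auto simp: w_def complex_eq_iff power2_eq_square algebra_simps)
    moreover have "1 / w v + 1 / w (- v) = (w v + w (- v)) / (w v * w (- v))"
      using calculation by (simp add: field_simps)
    ultimately have "1 / w v + 1 / w (- v) = of_real ((4 * pi * t) / (4 * pi\<^sup>2 * (v\<^sup>2 + t\<^sup>2)))"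
      by (simp only: of_real_divide)
    also have "(4 * pi * t) / (4 * pi\<^sup>2 * (v\<^sup>2 + t\<^sup>2)) = t / (pi * (v\<^sup>2 + t\<^sup>2))"
      by (simp add: power2_eq_square)
    finally show ?thesis .
  qed
  finally show ?thesis .
qed

lemma has_bochner_integral_poisson1:
  assumes t: "t > 0"
  shows "has_bochner_integral lborel (\<lambda>x. t / (pi * (x\<^sup>2 + t\<^sup>2))) (1::real)"
proof -
  define p where "p x = t / (pi * (x\<^sup>2 + t\<^sup>2))" for x
  have p0: "p x \<ge> 0" for x using t by (simp add: p_def)
  have [measurable]: "p \<in> borel_measurable borel" unfolding p_def by measurable
  have half: "(\<integral>\<^sup>+x. ennreal (p x) * indicator {0..} x \<partial>lborel) = ennreal (1/2 - arctan (0 / t) / pi)"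
  proof (rule nn_integral_FTC_atLeast)
    show "((\<lambda>x. arctan (x / t) / pi) has_real_derivative p x) (at x)" for x
    proof -
      have nz: "x\<^sup>2 + t\<^sup>2 \<noteq> 0" using t by (simp add: sum_power2_eq_zero_iff)
      have "((\<lambda>x. arctan (x / t) / pi) has_real_derivative (inverse (1 + (x / t)\<^sup>2) * (1 / t)) / pi) (at x)"
        using t by (auto intro!: derivative_eq_intros)
      also have "(inverse (1 + (x / t)\<^sup>2) * (1 / t)) / pi = p x"
      proof -
        have "1 + (x / t)\<^sup>2 = (x\<^sup>2 + t\<^sup>2) / t\<^sup>2" using t by (simp add: power_divide field_simps)
        then show ?thesis using t nz by (simp add: p_def power2_eq_square)
      qed
      finally show ?thesis .
    qed
    have "filterlim (\<lambda>x. x / t) at_top at_top"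
      using t by (intro filterlim_at_top_mult_tendsto_pos[where c = "1/t" and f = "\<lambda>_. 1/t" and g = "\<lambda>x. x", simplified]) (auto simp: filterlim_ident)
    then have "((\<lambda>x. arctan (x / t)) \<longlongrightarrow> pi / 2) at_top"
      by (rule filterlim_compose[OF tendsto_arctan_at_top])
    then have "((\<lambda>x. arctan (x / t) / pi) \<longlongrightarrow> (pi / 2) / pi) at_top"
      by (intro tendsto_divide tendsto_const) auto
    then show "((\<lambda>x. arctan (x / t) / pi) \<longlongrightarrow> 1/2) at_top" by simp
  qed (use p0 in auto)
  have sym: "(\<integral>\<^sup>+x. ennreal (p x) * indicator {..0} x \<partial>lborel) = (\<integral>\<^sup>+x. ennreal (p x) * indicator {0..} x \<partial>lborel)"
    by (subst nn_integral_real_affine[where c = "-1" and t = 0])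
       (auto simp: p_def indicator_def intro!: nn_integral_cong)
  have "(\<integral>\<^sup>+x. ennreal (p x) \<partial>lborel) = (\<integral>\<^sup>+x. ennreal (p x) * indicator {..0} x + ennreal (p x) * indicator {0..} x \<partial>lborel)"
    using AE_lborel_singleton[of 0] by (intro nn_integral_cong_AE) (auto simp: indicator_def elim!: eventually_mono)
  also have "\<dots> = ennreal (1/2) + ennreal (1/2)"
    by (subst nn_integral_add) (auto simp: sym half)
  also have "\<dots> = ennreal 1" by (subst ennreal_plus[symmetric]) auto
  finally have "(\<integral>\<^sup>+x. ennreal (p x) \<partial>lborel) = ennreal 1" .
  then have "has_bochner_integral lborel p 1" using p0 by (intro has_bochner_integral_nn_integral) auto
  then show ?thesis by (simp add: p_def[abs_def])
qed

lemma has_bochner_integral_poisson_kernel: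
  assumes "t \<in> pos_orthant"
  shows "has_bochner_integral lborel (poisson_kernel t) 1"
  using has_bochner_integral_prod_vec[of "\<lambda>i x. t $ i / (pi * (x\<^sup>2 + (t $ i)\<^sup>2))" "\<lambda>_. 1"] assms
  by (simp add: has_bochner_integral_poisson1 pos_orthant_def poisson_kernel_def[abs_def])

lemma poisson_kernel_nonneg: "t \<in> pos_orthant \<Longrightarrow> 0 \<le> poisson_kernel t x"
  unfolding poisson_kernel_def pos_orthant_def by (intro prod_nonneg) (auto intro!: divide_nonneg_nonneg simp: less_imp_le)

lemma poisson_kernel_measurable [measurable]: "poisson_kernel t \<in> borel_measurable borel"
  unfolding poisson_kernel_def[abs_def] by measurable

text \<open>The Fourier multiplier of the Poisson semigroup. The absolute values make it integrable
  over the whole space, so it also serves as an Abel summation weight for functions without any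
  spectral condition.\<close>

definition abel_factor :: "real^'n \<Rightarrow> real^'n \<Rightarrow> real" where
  "abel_factor t \<xi> = exp (- 2 * pi * (\<Sum>i\<in>UNIV. t $ i * \<bar>\<xi> $ i\<bar>))"

lemma abel_factor_measurable [measurable]: "abel_factor t \<in> borel_measurable borel"
  unfolding abel_factor_def[abs_def] by measurable

lemma has_bochner_integral_abel_factor:
  fixes t y :: "real^'n"
  assumes t: "t \<in> pos_orthant"
  shows "has_bochner_integral lborel (\<lambda>\<xi>. of_real (abel_factor t \<xi>) * exp (2 * of_real pi * \<i> * of_real (y \<bullet> \<xi>)))
    (of_real (poisson_kernel t y))"
proof -
  have "has_bochner_integral lborel (\<lambda>\<xi>::real^'n. \<Prod>i\<in>UNIV. exp (of_real (- 2 * pi * t $ i * \<bar>\<xi> $ i\<bar>) + 2 * of_real pi * \<i> * of_real (y $ i * \<xi> $ i)))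
     (\<Prod>i\<in>UNIV. of_real (t $ i / (pi * ((y $ i)\<^sup>2 + (t $ i)\<^sup>2))))"
    using t by (intro has_bochner_integral_prod_vec has_bochner_integral_exp_abs) (auto simp: pos_orthant_def)
  also have "(\<lambda>\<xi>::real^'n. \<Prod>i\<in>UNIV. exp (of_real (- 2 * pi * t $ i * \<bar>\<xi> $ i\<bar>) + 2 * of_real pi * \<i> * of_real (y $ i * \<xi> $ i)))
      = (\<lambda>\<xi>. of_real (abel_factor t \<xi>) * exp (2 * of_real pi * \<i> * of_real (y \<bullet> \<xi>)) :: complex)"
    by (simp add: abel_factor_def inner_vec_def sum_distrib_left sum_distrib_right sum.distrib mult_ac sum_negf sum_subtractf
        flip: exp_sum exp_of_real exp_add)
  finally show ?thesis by (simp add: poisson_kernel_def)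
qed

lemma integrable_abel_factor:
  assumes "t \<in> pos_orthant"
  shows "integrable lborel (abel_factor t)"
  using integrable_norm[OF has_bochner_integral_abel_factor[OF assms, of 0, THEN integrable.intros]]
  by (simp add: norm_mult abel_factor_def[abs_def])

text \<open>The function \<open>\<xi> \<mapsto> abel_factor t \<xi>\<close> times the character of
  frequency \<open>y\<close> has the reflected and translated Poisson kernel as its Fourier
  transform. The multiplication formula moves that transform over to \<open>f\<close>.\<close>

lemma poisson_integral_eq_fourier:
  assumes f: "integrable lborel f" and t: "t \<in> pos_orthant"
  shows "poisson_integral f (y, t) = (\<integral>\<xi>. fourier f \<xi> * of_real (abel_factor t \<xi>) * exp (2 * of_real pi * \<i> * of_real (y \<bullet> \<xi>)) \<partial>lborel)"
proof -
  define g where "g \<xi> = of_real (abel_factor t \<xi>) * exp (2 * of_real pi * \<i> * of_real (y \<bullet> \<xi>))" for \<xi>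
  have g: "integrable lborel g"
    using has_bochner_integral_abel_factor[OF t, of y] by (simp add: has_bochner_integral_iff g_def[abs_def])
  have "fourier g z = of_real (poisson_kernel t (y - z))" for z
  proof -
    have "fourier g z = (\<integral>\<xi>. of_real (abel_factor t \<xi>) * exp (2 * of_real pi * \<i> * of_real ((y - z) \<bullet> \<xi>)) \<partial>lborel)"
      unfolding fourier_def g_def
      by (intro Bochner_Integration.integral_cong refl)
         (simp add: inner_diff_left algebra_simps inner_commute flip: exp_add)
    then show ?thesis using has_bochner_integral_abel_factor[OF t, of "y - z"] by (simp add: has_bochner_integral_iff)
  qed
  then show ?thesis
    using fourier_multiplication[OF f g] by (simp add: poisson_integral_def g_def mult_ac)
qed

text \<open>Substituting \<open>z = y - e s\<close> uses that the kernel at equal heights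
  \<open>e\<close> is homogeneous of degree \<open>-n\<close>. The kernel becomes independent of
  \<open>e\<close>, which leaves only the shift in \<open>f\<close> to vary in a limit
  \<open>e \<longlonglongrightarrow> 0\<close>.\<close>

lemma poisson_integral_scaled:
  fixes f :: "real^'n \<Rightarrow> complex"
  assumes [measurable]: "f \<in> borel_measurable borel" and e: "e > 0"
  shows "poisson_integral f (y, e *\<^sub>R 1) = (\<integral>s. of_real (poisson_kernel 1 s) * f (y - e *\<^sub>R s) \<partial>lborel)"
proof -
  have "poisson_integral f (y, e *\<^sub>R 1) =
      \<bar>- e\<bar> ^ DIM(real^'n) *\<^sub>R (\<integral>s. of_real (poisson_kernel (e *\<^sub>R 1) (y - (y + (- e) *\<^sub>R s))) * f (y + (- e) *\<^sub>R s) \<partial>lborel)"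
    unfolding poisson_integral_def prod.case
    using e by (intro integral_affine_euclidean) auto
  also have "\<dots> = (\<integral>s. \<bar>- e\<bar> ^ DIM(real^'n) *\<^sub>R (of_real (poisson_kernel (e *\<^sub>R 1) (y - (y + (- e) *\<^sub>R s))) * f (y + (- e) *\<^sub>R s)) \<partial>lborel)"
    by simp
  also have "\<dots> = (\<integral>s. of_real (poisson_kernel 1 s) * f (y - e *\<^sub>R s) \<partial>lborel)"
  proof (intro Bochner_Integration.integral_cong refl)
    fix s :: "real^'n"
    have "e ^ CARD('n) * poisson_kernel (e *\<^sub>R 1) (e *\<^sub>R s) = (\<Prod>i\<in>UNIV. e * (e / (pi * ((e * s $ i)\<^sup>2 + e\<^sup>2))))"
      by (subst prod.distrib) (simp add: poisson_kernel_def)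
    also have "\<dots> = poisson_kernel 1 s" unfolding poisson_kernel_def
    proof (rule prod.cong[OF refl])
      fix i
      have "(e * s $ i)\<^sup>2 + e\<^sup>2 = e\<^sup>2 * ((s $ i)\<^sup>2 + 1)" by (simp add: power_mult_distrib algebra_simps)
      then show "e * (e / (pi * ((e * s $ i)\<^sup>2 + e\<^sup>2))) = 1 $ i / (pi * ((s $ i)\<^sup>2 + (1 $ i)\<^sup>2))"
        using e by (simp add: power2_eq_square)
    qed
    finally have "e ^ CARD('n) * poisson_kernel (e *\<^sub>R 1) (e *\<^sub>R s) = poisson_kernel 1 s" .
    then show "\<bar>- e\<bar> ^ DIM(real^'n) *\<^sub>R (of_real (poisson_kernel (e *\<^sub>R 1) (y - (y + (- e) *\<^sub>R s))) * f (y + (- e) *\<^sub>R s))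
      = of_real (poisson_kernel 1 s) * f (y - e *\<^sub>R s)"
      using e by (simp add: scaleR_conv_of_real mult.assoc[symmetric] flip: of_real_power of_real_mult)
  qed
  finally show ?thesis .
qed

section \<open>Plancherel identity and convolution\<close>

lemma one_pos_orthant: "e > 0 \<Longrightarrow> e *\<^sub>R (1::real^'n) \<in> pos_orthant"
  by (simp add: pos_orthant_def)

lemma poisson_integral_bounded:
  fixes f :: "real^'n \<Rightarrow> complex"
  assumes [measurable]: "f \<in> borel_measurable borel" and B: "\<And>x. cmod (f x) \<le> B" and e: "e > 0"
  shows "cmod (poisson_integral f (y, e *\<^sub>R 1)) \<le> B"
proof -
  have P: "has_bochner_integral lborel (poisson_kernel (1::real^'n)) 1"
    using has_bochner_integral_poisson_kernel[OF one_pos_orthant[of 1]] by simp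
  have P0: "0 \<le> poisson_kernel (1::real^'n) s" for s
    using poisson_kernel_nonneg[OF one_pos_orthant[of 1]] by simp
  have int: "integrable lborel (\<lambda>s. poisson_kernel (1::real^'n) s * B)"
    using P by (auto simp: has_bochner_integral_iff)
  have "cmod (poisson_integral f (y, e *\<^sub>R 1)) \<le> (\<integral>s. cmod (of_real (poisson_kernel (1::real^'n) s) * f (y - e *\<^sub>R s)) \<partial>lborel)"
    using e by (simp add: poisson_integral_scaled)
  also have "\<dots> \<le> (\<integral>s. poisson_kernel (1::real^'n) s * B \<partial>lborel)"
  proof (rule Bochner_Integration.integral_mono[OF _ int])
    show le: "cmod (of_real (poisson_kernel (1::real^'n) s) * f (y - e *\<^sub>R s)) \<le> poisson_kernel (1::real^'n) s * B" for s
      using B P0 by (simp add: norm_mult mult_left_mono)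
    show "integrable lborel (\<lambda>s. cmod (of_real (poisson_kernel (1::real^'n) s) * f (y - e *\<^sub>R s)))"
      using le by (intro Bochner_Integration.integrable_bound[OF int] AE_I2) (auto intro: order_trans[OF _ abs_ge_self])
  qed
  also have "\<dots> = B" using P by (simp add: has_bochner_integral_iff)
  finally show ?thesis .
qed

text \<open>Dominated convergence in the scaled form: the fixed kernel
  \<open>poisson_kernel 1\<close> has mass 1, and \<open>B\<close> times it is the majorant.\<close>

lemma poisson_integral_tendsto:
  fixes f :: "real^'n \<Rightarrow> complex"
  assumes cont: "continuous_on UNIV f" and B: "\<And>x. cmod (f x) \<le> B"
    and e: "\<And>n. e n > 0" "e \<longlonglongrightarrow> 0"
  shows "(\<lambda>n. poisson_integral f (y, e n *\<^sub>R 1)) \<longlonglongrightarrow> f y"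
proof -
  have [measurable]: "f \<in> borel_measurable borel" by (rule borel_measurable_continuous_onI[OF cont])
  have P: "has_bochner_integral lborel (poisson_kernel (1::real^'n)) 1"
    using has_bochner_integral_poisson_kernel[OF one_pos_orthant[of 1]] by simp
  have P0: "0 \<le> poisson_kernel (1::real^'n) s" for s
    using poisson_kernel_nonneg[OF one_pos_orthant[of 1]] by simp
  have "(\<lambda>n. \<integral>s. of_real (poisson_kernel (1::real^'n) s) * f (y - e n *\<^sub>R s) \<partial>lborel) \<longlonglongrightarrow> (\<integral>s. of_real (poisson_kernel (1::real^'n) s) * f y \<partial>lborel)"
  proof (rule integral_dominated_convergence[where w = "\<lambda>s::real^'n. poisson_kernel (1::real^'n) s * B"])
    show "integrable lborel (\<lambda>s. poisson_kernel (1::real^'n) s * B)"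
      using P by (auto simp: has_bochner_integral_iff)
    show "AE s in lborel. cmod (of_real (poisson_kernel (1::real^'n) s) * f (y - e n *\<^sub>R s)) \<le> poisson_kernel (1::real^'n) s * B" for n
      using B P0 by (simp add: norm_mult mult_left_mono)
    show "AE s in lborel. (\<lambda>n. of_real (poisson_kernel (1::real^'n) s) * f (y - e n *\<^sub>R s)) \<longlonglongrightarrow> of_real (poisson_kernel (1::real^'n) s) * f y"
    proof (rule AE_I2)
      fix s :: "real^'n"
      have "(\<lambda>n. y - e n *\<^sub>R s) \<longlonglongrightarrow> y - 0 *\<^sub>R s"
        using e by (intro tendsto_intros)
      then have "(\<lambda>n. f (y - e n *\<^sub>R s)) \<longlonglongrightarrow> f y"
        by (intro continuous_on_tendsto_compose[OF cont]) auto
      then show "(\<lambda>n. of_real (poisson_kernel (1::real^'n) s) * f (y - e n *\<^sub>R s)) \<longlonglongrightarrow> of_real (poisson_kernel (1::real^'n) s) * f y"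
        by (intro tendsto_mult tendsto_const)
    qed
  qed measurable
  also have "(\<integral>s. of_real (poisson_kernel (1::real^'n) s) * f y \<partial>lborel) = of_real (\<integral>s. poisson_kernel (1::real^'n) s \<partial>lborel) * f y"
    by simp
  also have "\<dots> = f y" using P by (simp add: has_bochner_integral_iff)
  finally show ?thesis using e by (simp add: poisson_integral_scaled)
qed

text \<open>Abel summation: inserting the factor \<open>abel_factor\<close> with parameter \<open>\<epsilon>\<close> on the left turns the
  multiplication formula into the integral of \<open>W\<close> against the conjugate of its Poisson integral at height
  \<open>\<epsilon>\<close>, so boundedness and continuity of \<open>W\<close> suffice for the passage to the limit.\<close>

lemma plancherel:
  fixes W :: "real^'n \<Rightarrow> complex"
  assumes int: "integrable lborel W" and cont: "continuous_on UNIV W" and B: "\<And>x. cmod (W x) \<le> B"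
  shows "(\<integral>\<^sup>+y. ennreal ((cmod (fourier W y))\<^sup>2) \<partial>lborel) = (\<integral>\<^sup>+R. ennreal ((cmod (W R))\<^sup>2) \<partial>lborel)"
proof -
  define e :: "nat \<Rightarrow> real" where "e n = 1 / real (Suc n)" for n
  have e: "e n > 0" for n by (simp add: e_def)
  have e_lim: "e \<longlonglongrightarrow> 0" unfolding e_def by (rule LIMSEQ_Suc[OF lim_1_over_n])
  define E where "E n = abel_factor (e n *\<^sub>R (1::real^'n))" for n
  have E_int: "integrable lborel (E n)" for n unfolding E_def by (intro integrable_abel_factor one_pos_orthant e)
  have E0: "E n y \<ge> 0" for n y by (simp add: E_def abel_factor_def)
  define C where "C = (\<integral>x. cmod (W x) \<partial>lborel)"
  have C: "cmod (fourier W y) \<le> C" for y unfolding C_def by (rule fourier_norm_le)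
  have [measurable]: "cnj \<in> borel_measurable borel"
    by (intro borel_measurable_continuous_onI continuous_on_cnj continuous_on_id)
  have [measurable]: "W \<in> borel_measurable borel" using int by auto
  have [measurable]: "fourier W \<in> borel_measurable borel" by (rule fourier_measurable[OF int])
  have [measurable]: "E n \<in> borel_measurable borel" for n by (simp add: E_def)
  have sqE_int: "integrable lborel (\<lambda>y. (cmod (fourier W y))\<^sup>2 * E n y)" for n
  proof (rule Bochner_Integration.integrable_bound)
    show "integrable lborel (\<lambda>y. C\<^sup>2 * E n y)" using E_int by simp
    show "AE y in lborel. norm ((cmod (fourier W y))\<^sup>2 * E n y) \<le> norm (C\<^sup>2 * E n y)"
      using C E0 by (intro AE_I2) (auto intro!: mult_right_mono power_mono)
  qed measurable
  have key: "of_real (\<integral>y. (cmod (fourier W y))\<^sup>2 * E n y \<partial>lborel) = (\<integral>b. W b * cnj (poisson_integral W (b, e n *\<^sub>R 1)) \<partial>lborel)" for n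
  proof -
    define g where "g y = cnj (fourier W y) * of_real (E n y)" for y
    have g: "integrable lborel g"
    proof (rule Bochner_Integration.integrable_bound)
      show "integrable lborel (\<lambda>y. C * E n y)" using E_int by simp
      show "AE y in lborel. norm (g y) \<le> norm (C * E n y)"
        using C E0 order_trans[OF norm_ge_zero C] by (intro AE_I2) (auto simp: g_def norm_mult intro!: mult_right_mono)
    qed (simp add: g_def[abs_def])
    have fg: "fourier g b = cnj (poisson_integral W (b, e n *\<^sub>R 1))" for b
    proof -
      have "fourier g b = (\<integral>y. cnj (fourier W y * of_real (E n y) * exp (2 * of_real pi * \<i> * of_real (b \<bullet> y))) \<partial>lborel)"
        unfolding fourier_def[of g] g_def by (simp add: exp_cnj inner_commute)
      also have "\<dots> = cnj (\<integral>y. fourier W y * of_real (E n y) * exp (2 * of_real pi * \<i> * of_real (b \<bullet> y)) \<partial>lborel)"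
        by (rule Bochner_Integration.integral_cnj)
      also have "\<dots> = cnj (poisson_integral W (b, e n *\<^sub>R 1))"
        by (simp add: poisson_integral_eq_fourier[OF int one_pos_orthant[OF e]] E_def)
      finally show ?thesis .
    qed
    have "of_real (\<integral>y. (cmod (fourier W y))\<^sup>2 * E n y \<partial>lborel) = (\<integral>y. fourier W y * g y \<partial>lborel)"
      unfolding g_def mult.assoc[symmetric] complex_norm_square[symmetric]
      by (simp flip: integral_complex_of_real)
    also have "\<dots> = (\<integral>b. W b * fourier g b \<partial>lborel)"
      by (rule fourier_multiplication[OF int g])
    also have "\<dots> = (\<integral>b. W b * cnj (poisson_integral W (b, e n *\<^sub>R 1)) \<partial>lborel)"
      by (simp add: fg)
    finally show ?thesis .
  qed
  have W2: "integrable lborel (\<lambda>b. (cmod (W b))\<^sup>2)"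
  proof (rule Bochner_Integration.integrable_bound)
    show "integrable lborel (\<lambda>b. B * cmod (W b))" using int by simp
    show "AE b in lborel. norm ((cmod (W b))\<^sup>2) \<le> norm (B * cmod (W b))"
      using B order_trans[OF norm_ge_zero B] by (intro AE_I2) (auto simp: power2_eq_square abs_mult intro!: mult_right_mono)
  qed measurable
  have "(\<lambda>n. \<integral>b. W b * cnj (poisson_integral W (b, e n *\<^sub>R 1)) \<partial>lborel) \<longlonglongrightarrow> (\<integral>b. W b * cnj (W b) \<partial>lborel)"
  proof (rule integral_dominated_convergence[where w = "\<lambda>b. cmod (W b) * B"])
    show "(\<lambda>b. W b * cnj (poisson_integral W (b, e n *\<^sub>R 1))) \<in> borel_measurable lborel" for n
      unfolding poisson_integral_def prod.case by measurable
    show "integrable lborel (\<lambda>b. cmod (W b) * B)" using int by simp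
    show "AE b in lborel. (\<lambda>n. W b * cnj (poisson_integral W (b, e n *\<^sub>R 1))) \<longlonglongrightarrow> W b * cnj (W b)"
      by (intro AE_I2 tendsto_intros poisson_integral_tendsto[OF cont B] e e_lim)
    show "AE b in lborel. norm (W b * cnj (poisson_integral W (b, e n *\<^sub>R 1))) \<le> cmod (W b) * B" for n
      using poisson_integral_bounded[of W B "e n"] B e by (auto simp: norm_mult intro!: mult_left_mono)
  qed measurable
  also have "(\<integral>b. W b * cnj (W b) \<partial>lborel) = of_real (\<integral>b. (cmod (W b))\<^sup>2 \<partial>lborel)"
    unfolding complex_norm_square[symmetric] by (simp flip: integral_complex_of_real)
  finally have lim: "(\<lambda>n. \<integral>y. (cmod (fourier W y))\<^sup>2 * E n y \<partial>lborel) \<longlonglongrightarrow> (\<integral>b. (cmod (W b))\<^sup>2 \<partial>lborel)"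
    unfolding key[symmetric] by (simp only: tendsto_of_real_iff)
  \<comment> \<open>Square integrability of \<open>fourier W\<close> is not known beforehand, so
    this side is treated in \<open>[0, infinity]\<close>: as \<open>e n\<close> decreases to 0 the
    Abel weights increase to 1, and monotone convergence applies.\<close>
  have "(\<lambda>n. \<integral>\<^sup>+y. ennreal ((cmod (fourier W y))\<^sup>2 * E n y) \<partial>lborel) \<longlonglongrightarrow> (\<integral>\<^sup>+y. ennreal ((cmod (fourier W y))\<^sup>2) \<partial>lborel)"
  proof (rule nn_integral_LIMSEQ)
    show "incseq (\<lambda>n y. ennreal ((cmod (fourier W y))\<^sup>2 * E n y))"
    proof (rule incseq_SucI, rule le_funI, rule ennreal_leI, rule mult_left_mono)
      fix n and y :: "real^'n"
      have "e (Suc n) \<le> e n" by (simp add: e_def frac_le)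
      then show "E n y \<le> E (Suc n) y"
        by (auto simp: E_def abel_factor_def intro!: sum_mono mult_right_mono)
    qed simp
    show "(\<lambda>n. ennreal ((cmod (fourier W y))\<^sup>2 * E n y)) \<longlonglongrightarrow> ennreal ((cmod (fourier W y))\<^sup>2)" for y
    proof -
      have "(\<lambda>n. (cmod (fourier W y))\<^sup>2 * exp (- 2 * pi * (\<Sum>i\<in>UNIV. e n * \<bar>y $ i\<bar>)))
          \<longlonglongrightarrow> (cmod (fourier W y))\<^sup>2 * exp (- 2 * pi * (\<Sum>i\<in>UNIV. 0 * \<bar>y $ i\<bar>))"
        by (intro tendsto_intros e_lim)
      then show ?thesis by (intro tendsto_ennrealI) (simp add: E_def abel_factor_def)
    qed
  qed measurable
  moreover have "(\<lambda>n. \<integral>\<^sup>+y. ennreal ((cmod (fourier W y))\<^sup>2 * E n y) \<partial>lborel) \<longlonglongrightarrow> ennreal (\<integral>b. (cmod (W b))\<^sup>2 \<partial>lborel)"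
    using tendsto_ennrealI[OF lim] E0 sqE_int by (simp add: nn_integral_eq_integral)
  ultimately have "(\<integral>\<^sup>+y. ennreal ((cmod (fourier W y))\<^sup>2) \<partial>lborel) = ennreal (\<integral>b. (cmod (W b))\<^sup>2 \<partial>lborel)"
    by (rule LIMSEQ_unique)
  then show ?thesis using W2 by (simp add: nn_integral_eq_integral)
qed

section \<open>Convolution of an integrable kernel with a bounded or integrable function\<close>

definition convol :: "(real^'n \<Rightarrow> complex) \<Rightarrow> (real^'n \<Rightarrow> complex) \<Rightarrow> real^'n \<Rightarrow> complex" where
  "convol K g R = (\<integral>s. K s * g (R - s) \<partial>lborel)"

lemma convol_commute:
  fixes K g :: "real^'n \<Rightarrow> complex"
  assumes [measurable]: "K \<in> borel_measurable borel" "g \<in> borel_measurable borel"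
  shows "convol K g R = (\<integral>\<xi>. K (R - \<xi>) * g \<xi> \<partial>lborel)"
  using integral_affine_euclidean[of "\<lambda>s. K s * g (R - s)" "-1" R] by (simp add: convol_def)

lemma convol_bounded:
  assumes K: "integrable lborel K" and [measurable]: "g \<in> borel_measurable borel" and B: "\<And>x. cmod (g x) \<le> B"
  shows "cmod (convol K g R) \<le> (\<integral>s. cmod (K s) * B \<partial>lborel)"
  unfolding convol_def
proof (rule order_trans[OF Bochner_Integration.integral_norm_bound Bochner_Integration.integral_mono])
  have [measurable]: "K \<in> borel_measurable borel" using K by auto
  show le: "cmod (K s * g (R - s)) \<le> cmod (K s) * B" for s
    using B by (simp add: norm_mult mult_left_mono)
  show int: "integrable lborel (\<lambda>s. cmod (K s) * B)" using K by simp
  show "integrable lborel (\<lambda>s. cmod (K s * g (R - s)))"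
    using le by (intro Bochner_Integration.integrable_bound[OF int] AE_I2) (auto intro: order_trans[OF _ abs_ge_self])
qed

text \<open>All regularity is taken from \<open>g\<close>. The kernels \<open>K\<close> of interest
  have a singularity at the coordinate hyperplanes as soon as some exponent is below 1.\<close>

lemma continuous_on_convol:
  assumes K: "integrable lborel K" and g: "continuous_on UNIV g" and B: "\<And>x. cmod (g x) \<le> B"
  shows "continuous_on UNIV (convol K g)"
proof -
  have [measurable]: "K \<in> borel_measurable borel" using K by auto
  have [measurable]: "g \<in> borel_measurable borel" by (rule borel_measurable_continuous_onI[OF g])
  show ?thesis unfolding convol_def[abs_def]
  proof (rule continuous_on_lebesgue_integral[where g = "\<lambda>s. cmod (K s) * B"])
    show "continuous_on UNIV (\<lambda>R. K s * g (R - s))" for s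
      by (intro continuous_intros continuous_on_compose2[OF g]) auto
  qed (use K B in \<open>auto simp: norm_mult intro!: mult_left_mono\<close>)
qed

lemma
  assumes K: "integrable lborel K" and g: "integrable lborel g"
  shows integrable_convol: "integrable lborel (convol K g)"
    and fourier_convol: "fourier (convol K g) \<xi> = fourier K \<xi> * fourier g \<xi>"
proof -
  have [measurable]: "K \<in> borel_measurable borel" "g \<in> borel_measurable borel" using K g by auto
  let ?e = "\<lambda>x. exp (- 2 * of_real pi * \<i> * of_real (x \<bullet> \<xi>)) :: complex"
  have int: "integrable (lborel \<Otimes>\<^sub>M lborel) (\<lambda>(s, R). K s * g (R - s))"
  proof (rule lborel_pair.Fubini_integrable)
    show "AE s in lborel. integrable lborel (\<lambda>R. (case (s, R) of (s, R) \<Rightarrow> K s * g (R - s)))"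
      using integrable_shift[OF g] by simp
    have "(\<integral>R. cmod (K s * g (R - s)) \<partial>lborel) = cmod (K s) * (\<integral>R. cmod (g R) \<partial>lborel)" for s
      using integral_shift[OF integrable_norm[OF g], of s] by (simp add: norm_mult)
    then show "integrable lborel (\<lambda>s. \<integral>R. norm (case (s, R) of (s, R) \<Rightarrow> K s * g (R - s)) \<partial>lborel)"
      using K by simp
  qed measurable
  show "integrable lborel (convol K g)"
    using lborel_pair.integrable_snd[OF int] by (simp add: convol_def[abs_def])
  have int': "integrable (lborel \<Otimes>\<^sub>M lborel) (\<lambda>(s, R). K s * g (R - s) * ?e R)"
    by (rule Bochner_Integration.integrable_bound[OF int]) (auto simp: norm_mult)
  have "fourier (convol K g) \<xi> = (\<integral>R. (\<integral>s. K s * g (R - s) * ?e R \<partial>lborel) \<partial>lborel)"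
    by (simp add: fourier_def convol_def)
  also have "\<dots> = (\<integral>s. (\<integral>R. K s * g (R - s) * ?e R \<partial>lborel) \<partial>lborel)"
    by (rule lborel_pair.Fubini_integral[OF int'])
  also have "\<dots> = (\<integral>s. (K s * ?e s) * fourier g \<xi> \<partial>lborel)"
  proof (rule Bochner_Integration.integral_cong[OF refl])
    fix s
    have ge: "integrable lborel (\<lambda>R. g R * ?e R)"
      by (rule Bochner_Integration.integrable_bound[OF g]) (auto simp: norm_mult)
    have "(\<integral>R. K s * g (R - s) * ?e R \<partial>lborel) = (\<integral>R. (K s * ?e s) * (g (R - s) * ?e (R - s)) \<partial>lborel)"
      by (intro Bochner_Integration.integral_cong refl)
         (simp add: mult_ac inner_diff_left flip: exp_add, simp add: algebra_simps)
    also have "\<dots> = (K s * ?e s) * (\<integral>R. g (R - s) * ?e (R - s) \<partial>lborel)"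
      by simp
    also have "(\<integral>R. g (R - s) * ?e (R - s) \<partial>lborel) = fourier g \<xi>"
      unfolding fourier_def by (rule integral_shift[OF ge])
    finally show "(\<integral>R. K s * g (R - s) * ?e R \<partial>lborel) = (K s * ?e s) * fourier g \<xi>" .
  qed
  also have "\<dots> = fourier K \<xi> * fourier g \<xi>" by (simp add: fourier_def)
  finally show "fourier (convol K g) \<xi> = fourier K \<xi> * fourier g \<xi>" .
qed

section \<open>Functions with spectrum in the open orthant\<close>

text \<open>The bounds on monomials of degree 0 or 2 in each variable control \<open>f\<close> times
  the product of the \<open>1 + x_i^2\<close>. Hence \<open>f\<close> is dominated by a multiple of
  the Poisson kernel at height 1, whose integral is known.\<close>

lemma schwartz_integrable:
  fixes f :: "real^'n \<Rightarrow> complex"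
  assumes "f \<in> schwartz_space"
  shows "integrable lborel f"
proof -
  have cont: "continuous_on UNIV f"
  proof -
    have "continuous_on UNIV (partials [] f)" using assms unfolding schwartz_space_def smooth_def by blast
    then show ?thesis by (simp add: partials_def)
  qed
  have [measurable]: "f \<in> borel_measurable borel" by (rule borel_measurable_continuous_onI[OF cont])
  have "\<exists>B. \<forall>x. cmod (of_real (\<Prod>i\<in>UNIV. (x $ i) ^ \<alpha> i) * f x) \<le> B" for \<alpha> :: "'n \<Rightarrow> nat"
  proof -
    have "bounded (range (\<lambda>x. of_real (\<Prod>i\<in>UNIV. (x $ i) ^ \<alpha> i) * partials [] f x))"
      using assms unfolding schwartz_space_def by blast
    then show ?thesis by (auto simp: bounded_iff partials_def)
  qed
  then obtain B where B: "cmod (of_real (\<Prod>i\<in>UNIV. (x $ i) ^ \<alpha> i) * f x) \<le> B \<alpha>" for \<alpha> :: "'n \<Rightarrow> nat" and x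
    by metis
  \<comment> \<open>The monomial used at a point depends on the set \<open>S\<close> of coordinates
    with \<open>\<bar>x $ i\<bar> > 1\<close>: there \<open>1 + x_i^2 \<le> 2 x_i^2\<close>,
    elsewhere \<open>1 + x_i^2 \<le> 2\<close>. Summing the bounds over all \<open>S\<close> gives
    one constant for all points.\<close>
  define D where "D = (\<Sum>S\<in>Pow UNIV. B (\<lambda>i. if i \<in> S then 2 else 0))"
  have bound: "cmod (f x) \<le> 2 ^ CARD('n) * D * pi ^ CARD('n) * poisson_kernel 1 x" for x
  proof -
    define S where "S = {i. \<bar>x $ i\<bar> > 1}"
    define \<alpha> :: "'n \<Rightarrow> nat" where "\<alpha> i = (if i \<in> S then 2 else 0)" for i
    have B0: "B \<beta> \<ge> 0" for \<beta> using order_trans[OF norm_ge_zero B] .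
    have "B \<alpha> \<le> D" unfolding D_def \<alpha>_def
      by (rule member_le_sum[of S "Pow UNIV" "\<lambda>S. B (\<lambda>i. if i \<in> S then 2 else 0)"]) (auto simp: B0)
    have "(\<Prod>i\<in>UNIV. 1 + (x $ i)\<^sup>2) \<le> (\<Prod>i\<in>UNIV. 2 * (x $ i) ^ \<alpha> i)"
    proof (rule prod_mono, safe)
      fix i
      show "1 + (x $ i)\<^sup>2 \<le> 2 * (x $ i) ^ \<alpha> i"
        using abs_square_le_1[of "x $ i"] power2_le_iff_abs_le[of 1 "x $ i"]
        by (cases "i \<in> S") (auto simp: \<alpha>_def S_def abs_le_square_iff[of 1, simplified] less_imp_le)
    qed (auto intro: add_nonneg_nonneg)
    also have "\<dots> = 2 ^ CARD('n) * (\<Prod>i\<in>UNIV. (x $ i) ^ \<alpha> i)" by (simp add: prod.distrib)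
    finally have "(\<Prod>i\<in>UNIV. 1 + (x $ i)\<^sup>2) * cmod (f x) \<le> 2 ^ CARD('n) * (\<Prod>i\<in>UNIV. (x $ i) ^ \<alpha> i) * cmod (f x)"
      by (intro mult_right_mono) auto
    also have "\<dots> = 2 ^ CARD('n) * cmod (of_real (\<Prod>i\<in>UNIV. (x $ i) ^ \<alpha> i) * f x)"
    proof -
      have "0 \<le> (\<Prod>i\<in>UNIV. (x $ i) ^ \<alpha> i)" by (intro prod_nonneg) (auto simp: \<alpha>_def)
      then show ?thesis by (simp add: norm_mult del: of_real_prod)
    qed
    also have "\<dots> \<le> 2 ^ CARD('n) * D" using B[of x \<alpha>] \<open>B \<alpha> \<le> D\<close> by (intro mult_left_mono) auto
    finally have main: "(\<Prod>i\<in>UNIV. 1 + (x $ i)\<^sup>2) * cmod (f x) \<le> 2 ^ CARD('n) * D" .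
    have pos: "(\<Prod>i\<in>UNIV. 1 + (x $ i)\<^sup>2) > 0" by (intro prod_pos) (auto intro: add_pos_nonneg)
    have eq: "pi ^ CARD('n) * poisson_kernel 1 x = inverse (\<Prod>i\<in>UNIV. 1 + (x $ i)\<^sup>2)"
      by (simp add: poisson_kernel_def prod_dividef prod.distrib divide_inverse add.commute
          mult.assoc[symmetric] flip: power_mult_distrib prod_inversef)
    have "cmod (f x) \<le> 2 ^ CARD('n) * D * inverse (\<Prod>i\<in>UNIV. 1 + (x $ i)\<^sup>2)"
      using main pos by (simp add: field_simps)
    then show ?thesis unfolding eq[symmetric] by (simp add: mult.assoc)
  qed
  have "has_bochner_integral lborel (poisson_kernel (1::real^'n)) 1"
    using has_bochner_integral_poisson_kernel[OF one_pos_orthant[of 1]] by simp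
  then have "integrable lborel (\<lambda>x. 2 ^ CARD('n) * D * pi ^ CARD('n) * poisson_kernel (1::real^'n) x)"
    by (intro integrable_mult_right) (auto simp: has_bochner_integral_iff)
  then show ?thesis
    by (rule Bochner_Integration.integrable_bound[OF _ _ AE_I2]) (auto intro: order_trans[OF bound abs_ge_self])
qed

text \<open>If \<open>F\<close> were nonzero at a point with some coordinate \<open>\<le> 0\<close>,
  it would stay nonzero after a small step in the negative direction of that coordinate, outside
  \<open>D0\<close>. Continuity thus clears the boundary faces too, so later estimates may take all
  \<open>\<xi> $ i\<close> strictly positive.\<close>

lemma zero_outside_pos_orthant:
  assumes cont: "continuous_on UNIV F" and supp: "closure {\<xi>. F \<xi> \<noteq> (0::complex)} \<subseteq> D0" and \<xi>: "\<xi> \<notin> pos_orthant"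
  shows "F \<xi> = 0"
proof (rule ccontr)
  assume nz: "F \<xi> \<noteq> 0"
  have "open {\<xi>. F \<xi> \<noteq> 0}" by (intro open_Collect_neq cont continuous_intros)
  then obtain e where e: "e > 0" "ball \<xi> e \<subseteq> {\<xi>. F \<xi> \<noteq> 0}" using nz by (auto simp: open_contains_ball)
  obtain i where i: "\<xi> $ i \<le> 0" using \<xi> by (auto simp: pos_orthant_def not_less)
  have "\<xi> - (e/2) *\<^sub>R axis i 1 \<in> ball \<xi> e" using e by (simp add: dist_norm norm_axis_1)
  with e supp closure_subset have "\<xi> - (e/2) *\<^sub>R axis i 1 \<in> D0" by blast
  then have "0 \<le> (\<xi> - (e/2) *\<^sub>R axis i 1) $ i" unfolding D0_def by blast
  then show False using i e by (simp add: axis_def)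
qed

lemma open_pos_orthant: "open (pos_orthant :: (real^'n) set)"
proof -
  have eq: "pos_orthant = (\<Inter>i\<in>UNIV. {R::real^'n. R $ i > 0})" by (auto simp: pos_orthant_def)
  show ?thesis unfolding eq by (intro open_INT ballI open_halfspace_component_gt_cart) auto
qed

lemma pos_orthant_measurable [measurable]: "pos_orthant \<in> sets borel"
  by (rule borel_open[OF open_pos_orthant])

lemma pos_orthantD: "t \<in> pos_orthant \<Longrightarrow> 0 < t $ i"
  by (simp add: pos_orthant_def)

lemma nn_integral_reflect_shift:
  fixes f :: "'a::euclidean_space \<Rightarrow> ennreal"
  assumes [measurable]: "f \<in> borel_measurable borel"
  shows "(\<integral>\<^sup>+x. f (t - x) \<partial>lborel) = (\<integral>\<^sup>+x. f x \<partial>lborel)"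
  by (subst (2) lborel_affine[of "-1" t]) (auto simp: nn_integral_density nn_integral_distr)

lemma cmod_powr_of_real: "w \<noteq> 0 \<Longrightarrow> cmod (w powr of_real a) = cmod w powr a"
  by (simp add: powr_def norm_exp_eq_Re)

text \<open>\<open>F\<close> stands for the Fourier transform of \<open>f\<close>, and
  \<open>C\<close> for the \<open>L^1\<close> norm of \<open>f\<close>.\<close>

locale half_spectrum =
  fixes F :: "real^'n \<Rightarrow> complex" and C :: real
  assumes cont: "continuous_on UNIV F" and bound: "\<And>\<xi>. cmod (F \<xi>) \<le> C"
    and supp: "\<And>\<xi>. \<xi> \<notin> pos_orthant \<Longrightarrow> F \<xi> = 0"
begin

lemma F_measurable [measurable]: "F \<in> borel_measurable borel"
  by (rule borel_measurable_continuous_onI[OF cont])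

lemma C_nonneg: "0 \<le> C" using order_trans[OF norm_ge_zero bound] .

section \<open>Damped plane waves and the mixed derivatives of their superpositions\<close>

text \<open>This is \<open>exp (2 \<pi> i z \<bullet> \<xi>)\<close> with
  \<open>z = y + i t\<close>, hence holomorphic in each \<open>z_j\<close>. By Cauchy-Riemann the
  derivatives in \<open>y_j\<close> and \<open>t_j\<close> differ by a unimodular factor.\<close>

definition wave :: "real^'n \<Rightarrow> real^'n \<Rightarrow> real^'n \<Rightarrow> complex" where
  "wave y t \<xi> = exp (of_real (- 2 * pi * (t \<bullet> \<xi>)) + 2 * of_real pi * \<i> * of_real (y \<bullet> \<xi>))"

text \<open>\<open>S\<close> records the coordinates already differentiated: the empty set gives the
  Poisson integral, \<open>UNIV\<close> the function \<open>G\<close>.\<close>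

definition wave_integral :: "'n set \<Rightarrow> real^'n \<Rightarrow> real^'n \<Rightarrow> complex" where
  "wave_integral S y t = (\<integral>\<xi>. F \<xi> * of_real (\<Prod>j\<in>S. \<xi> $ j) * wave y t \<xi> \<partial>lborel)"

lemma norm_wave: "cmod (wave y t \<xi>) = exp (- 2 * pi * (t \<bullet> \<xi>))"
  by (simp add: wave_def norm_exp_eq_Re)

lemma wave_measurable [measurable]: "wave y t \<in> borel_measurable borel"
  unfolding wave_def[abs_def] by measurable

text \<open>On the orthant the monomial over \<open>S\<close> is a product of
  \<open>lap_kernel 2\<close> in the coordinates of \<open>S\<close> and \<open>lap_kernel 1\<close>
  in the others. With \<open>F\<close> bounded by \<open>C\<close>, a product of one-dimensional
  Gamma integrals is the majorant.\<close>

lemma integrable_wave_majorant: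
  assumes t: "t \<in> pos_orthant"
  shows "integrable lborel (\<lambda>\<xi>. cmod (F \<xi> * of_real (\<Prod>j\<in>S. \<xi> $ j)) * exp (- 2 * pi * (t \<bullet> \<xi>)))"
proof (rule Bochner_Integration.integrable_bound)
  show "integrable lborel (\<lambda>\<xi>::real^'n. C * (\<Prod>i\<in>UNIV. lap_kernel (if i \<in> S then 2 else 1) (\<xi> $ i) * exp (- (2 * pi * t $ i) * (\<xi> $ i))))"
  proof -
    have "has_bochner_integral lborel (\<lambda>s. lap_kernel (if i \<in> S then 2 else 1) s * exp (- (2 * pi * t $ i) * s))
        (Gamma (if i \<in> S then 2 else 1) / (2 * pi * t $ i) powr (if i \<in> S then 2 else 1))" for i
      using t by (intro has_bochner_integral_lap_kernel_real) (auto simp: pos_orthant_def)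
    from has_bochner_integral_prod_vec[OF this] show ?thesis
      by (intro integrable_mult_right integrable.intros)
  qed
  show "AE \<xi> in lborel. norm (cmod (F \<xi> * of_real (\<Prod>j\<in>S. \<xi> $ j)) * exp (- 2 * pi * (t \<bullet> \<xi>)))
      \<le> norm (C * (\<Prod>i\<in>UNIV. lap_kernel (if i \<in> S then 2 else 1) (\<xi> $ i) * exp (- (2 * pi * t $ i) * (\<xi> $ i))))"
  proof (rule AE_I2)
    fix \<xi> :: "real^'n"
    show "norm (cmod (F \<xi> * of_real (\<Prod>j\<in>S. \<xi> $ j)) * exp (- 2 * pi * (t \<bullet> \<xi>)))
      \<le> norm (C * (\<Prod>i\<in>UNIV. lap_kernel (if i \<in> S then 2 else 1) (\<xi> $ i) * exp (- (2 * pi * t $ i) * (\<xi> $ i))))"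
    proof (cases "\<xi> \<in> pos_orthant")
      case True
      then have pos: "0 < \<xi> $ i" for i by (rule pos_orthantD)
      have "(\<Prod>i\<in>UNIV. lap_kernel (if i \<in> S then 2 else 1) (\<xi> $ i)) = (\<Prod>i\<in>UNIV. if i \<in> S then \<xi> $ i else 1)"
        using pos by (intro prod.cong refl) (auto simp: lap_kernel_def abs_of_pos[OF pos] less_imp_neq[OF pos, symmetric])
      also have "\<dots> = (\<Prod>i\<in>S. \<xi> $ i)" by (simp add: prod.If_cases)
      finally have 1: "(\<Prod>i\<in>UNIV. lap_kernel (if i \<in> S then 2 else 1) (\<xi> $ i)) = (\<Prod>i\<in>S. \<xi> $ i)" .
      have 2: "(\<Prod>i\<in>UNIV. exp (- (2 * pi * t $ i) * (\<xi> $ i))) = exp (- 2 * pi * (t \<bullet> \<xi>))"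
        by (simp add: inner_vec_def sum_distrib_left sum_negf mult_ac flip: exp_sum)
      have 3: "(\<Prod>i\<in>S. \<xi> $ i) \<ge> 0" using pos by (intro prod_nonneg) (auto simp: less_imp_le)
      show ?thesis
        unfolding prod.distrib 1 2 using 3 C_nonneg bound[of \<xi>]
        by (auto simp: norm_mult abs_mult mult.assoc intro!: mult_right_mono simp del: of_real_prod)
    qed (simp add: supp)
  qed
qed measurable

lemma wave_integral_derivative:
  assumes t: "t \<in> pos_orthant" and j: "j \<notin> S" and c: "cmod c = 2 * pi"
    and dir: "\<And>s::real. \<And>\<xi>. wave (y + s *\<^sub>R v1) (t + s *\<^sub>R v2) \<xi> = wave y t \<xi> * exp (of_real s * (c * of_real (\<xi> $ j)))"
  shows "((\<lambda>s::real. wave_integral S (y + s *\<^sub>R v1) (t + s *\<^sub>R v2)) has_vector_derivative (c * wave_integral (insert j S) y t)) (at 0)"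
proof -
  define w where "w \<xi> = F \<xi> * of_real (\<Prod>j\<in>S. \<xi> $ j) * wave y t \<xi>" for \<xi>
  have [measurable]: "w \<in> borel_measurable borel" unfolding w_def[abs_def] by measurable
  \<comment> \<open>Giving up half of the height \<open>t $ j\<close> supplies the exponential
    moment of order \<open>t $ j / 2\<close>: since \<open>cmod c = 2 * pi\<close>, both sides gain
    the factor \<open>exp (pi * t $ j * \<xi> $ j)\<close>.\<close>
  define \<tau> where "\<tau> = t - (t $ j / 2) *\<^sub>R axis j 1"
  have \<tau>: "\<tau> \<in> pos_orthant" using t by (auto simp: \<tau>_def pos_orthant_def axis_def)
  have "((\<lambda>h. \<integral>\<xi>. w \<xi> * exp (h * (c * of_real (\<xi> $ j))) \<partial>lborel) has_field_derivative (\<integral>\<xi>. w \<xi> * (c * of_real (\<xi> $ j)) \<partial>lborel)) (at 0)"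
  proof (rule has_field_derivative_integral_exp[where d = "t $ j / 2"])
    show "integrable lborel (\<lambda>\<xi>. cmod (w \<xi>) * exp (t $ j / 2 * cmod (c * of_real (\<xi> $ j))))"
    proof (rule Bochner_Integration.integrable_cong[THEN iffD1, OF refl _ integrable_wave_majorant[OF \<tau>, of S]])
      fix \<xi> :: "real^'n"
      show "cmod (F \<xi> * of_real (\<Prod>j\<in>S. \<xi> $ j)) * exp (- 2 * pi * (\<tau> \<bullet> \<xi>)) = cmod (w \<xi>) * exp (t $ j / 2 * cmod (c * of_real (\<xi> $ j)))"
      proof (cases "\<xi> \<in> pos_orthant")
        case True
        then have "0 < \<xi> $ j" by (rule pos_orthantD)
        then have "exp (- 2 * pi * (\<tau> \<bullet> \<xi>)) = exp (- 2 * pi * (t \<bullet> \<xi>)) * exp (t $ j / 2 * cmod (c * of_real (\<xi> $ j)))"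
          by (simp add: \<tau>_def inner_diff_left inner_axis' norm_mult c algebra_simps flip: exp_add)
        then show ?thesis by (simp add: w_def norm_mult norm_wave)
      qed (simp add: w_def supp)
    qed
  qed (use t in \<open>auto simp: pos_orthantD\<close>)
  then have "((\<lambda>s::real. \<integral>\<xi>. w \<xi> * exp (of_real s * (c * of_real (\<xi> $ j))) \<partial>lborel) has_vector_derivative (\<integral>\<xi>. w \<xi> * (c * of_real (\<xi> $ j)) \<partial>lborel)) (at 0)"
    by (intro has_vector_derivative_real_field) simp
  also have "(\<lambda>s::real. \<integral>\<xi>. w \<xi> * exp (of_real s * (c * of_real (\<xi> $ j))) \<partial>lborel) = (\<lambda>s. wave_integral S (y + s *\<^sub>R v1) (t + s *\<^sub>R v2))"
    by (simp add: wave_integral_def dir w_def mult.assoc)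
  also have "(\<integral>\<xi>. w \<xi> * (c * of_real (\<xi> $ j)) \<partial>lborel) = (\<integral>\<xi>. c * (F \<xi> * of_real (\<Prod>j\<in>insert j S. \<xi> $ j) * wave y t \<xi>) \<partial>lborel)"
    using j by (simp add: w_def mult_ac)
  also have "\<dots> = c * wave_integral (insert j S) y t"
    by (simp add: wave_integral_def)
  finally show ?thesis .
qed

text \<open>The coefficient of \<open>\<xi> $ j\<close> brought down from \<open>wave\<close> by one
  half-plane derivative in coordinate \<open>j\<close>.\<close>

definition hfactor :: "nat \<Rightarrow> complex" where
  "hfactor k = (if k = 0 then - 2 * of_real pi else 2 * of_real pi * \<i>)"

lemma norm_hfactor: "cmod (hfactor k) = 2 * pi"
  by (simp add: hfactor_def norm_mult)

lemma half_partial_wave_integral: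
  assumes U: "\<And>y t. t \<in> pos_orthant \<Longrightarrow> U (y, t) = a * wave_integral S y t" and t: "t \<in> pos_orthant" and j: "j \<notin> S"
  shows "half_partial k j U (y, t) = (hfactor k * a) * wave_integral (insert j S) y t"
proof -
  define v1 :: "real^'n" where "v1 = (if k = 0 then 0 else axis j 1)"
  define v2 :: "real^'n" where "v2 = (if k = 0 then axis j 1 else 0)"
  have "((\<lambda>s::real. wave_integral S (y + s *\<^sub>R v1) (t + s *\<^sub>R v2)) has_vector_derivative (hfactor k * wave_integral (insert j S) y t)) (at 0)"
    by (rule wave_integral_derivative[OF t j norm_hfactor])
       (simp add: wave_def v1_def v2_def hfactor_def inner_add_left inner_axis' algebra_simps flip: exp_add)
  then have "((\<lambda>s::real. a * wave_integral S (y + s *\<^sub>R v1) (t + s *\<^sub>R v2)) has_vector_derivative (a * (hfactor k * wave_integral (insert j S) y t))) (at 0)"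
    by (rule has_vector_derivative_mult_right)
  then have "((\<lambda>s::real. U ((y, t) + s *\<^sub>R (v1, v2))) has_vector_derivative (a * (hfactor k * wave_integral (insert j S) y t))) (at 0)"
  proof (rule has_vector_derivative_transform_within_open)
    \<comment> \<open>The formula for \<open>U\<close> is available only over the open orthant. For
      parameters smaller than \<open>t $ j\<close> in modulus the line stays there, and the
      derivative at 0 sees nothing else.\<close>
    show "open {- (t $ j)<..<t $ j}" "0 \<in> {- (t $ j)<..<t $ j}" using pos_orthantD[OF t] by auto
    fix s assume "s \<in> {- (t $ j)<..<t $ j}"
    then have "t + s *\<^sub>R v2 \<in> pos_orthant" using t by (auto simp: v2_def pos_orthant_def axis_def)
    then show "a * wave_integral S (y + s *\<^sub>R v1) (t + s *\<^sub>R v2) = U ((y, t) + s *\<^sub>R (v1, v2))" by (simp add: U)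
  qed
  then show ?thesis
    by (auto simp: half_partial_def dir_deriv_def v1_def v2_def mult_ac dest!: vector_derivative_at split: if_splits)
qed

lemma foldr_half_partial:
  assumes U: "\<And>y t. t \<in> pos_orthant \<Longrightarrow> U (y, t) = wave_integral {} y t" and "distinct js" and t: "t \<in> pos_orthant"
  shows "foldr (\<lambda>j. half_partial (k j) j) js U (y, t) = (\<Prod>j\<in>set js. hfactor (k j)) * wave_integral (set js) y t"
  using assms(2) t
proof (induction js arbitrary: y t)
  case (Cons j js)
  then have IH: "t \<in> pos_orthant \<Longrightarrow> foldr (\<lambda>j. half_partial (k j) j) js U (y, t) = (\<Prod>j\<in>set js. hfactor (k j)) * wave_integral (set js) y t" for y t
    by simp
  show ?case using half_partial_wave_integral[OF IH, of t j "k j" y] Cons.prems by simp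
qed (simp add: U)

lemma integrable_wave_integrand:
  assumes "t \<in> pos_orthant"
  shows "integrable lborel (\<lambda>\<xi>. F \<xi> * of_real (\<Prod>j\<in>S. \<xi> $ j) * wave y t \<xi>)"
  using integrable_wave_majorant[OF assms, of S]
  by (rule Bochner_Integration.integrable_bound) (auto simp: norm_mult norm_wave)

lemma wave_integral_measurable [measurable]: "(\<lambda>(y, t). wave_integral S y t) \<in> borel_measurable (borel \<Otimes>\<^sub>M borel)"
  unfolding wave_integral_def wave_def by measurable

end

text \<open>Every mixed partial has modulus \<open>(2 * pi) ^ n\<close> times that of
  \<open>G\<close>, and there are \<open>2 ^ n\<close> choices of derivatives. Per coordinate this
  gives \<open>2 * (2 * pi)\<^sup>2 = 8 * pi\<^sup>2\<close>.\<close>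

lemma grad_sq_eq:
  fixes F :: "real^'n::{finite,linorder} \<Rightarrow> complex"
  assumes "half_spectrum F C" and U: "\<And>y t. t \<in> pos_orthant \<Longrightarrow> U (y, t) = half_spectrum.wave_integral F {} y t" and t: "t \<in> pos_orthant"
  shows "grad_sq U (y, t) = (8 * pi\<^sup>2) ^ CARD('n) * (cmod (half_spectrum.wave_integral F UNIV y t))\<^sup>2"
proof -
  interpret half_spectrum F C by fact
  have "mixed_partial k U (y, t) = (\<Prod>j\<in>UNIV. hfactor (k j)) * wave_integral UNIV y t" for k
    using foldr_half_partial[OF U, of "sorted_list_of_set UNIV" t k y] t by (simp add: mixed_partial_def)
  then have n: "cmod (mixed_partial k U (y, t)) = (2 * pi) ^ CARD('n) * cmod (wave_integral UNIV y t)" for k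
    by (simp only: norm_mult prod_norm[symmetric] norm_hfactor prod_constant)
  have pow: "((2 * pi) ^ CARD('n))\<^sup>2 = (4 * pi\<^sup>2) ^ CARD('n)"
  proof -
    have "((2 * pi) ^ CARD('n))\<^sup>2 = ((2 * pi)\<^sup>2) ^ CARD('n)" by (simp only: power_mult[symmetric] mult.commute)
    then show ?thesis by (simp add: power2_eq_square)
  qed
  have "(cmod (mixed_partial k U (y, t)))\<^sup>2 = (4 * pi\<^sup>2) ^ CARD('n) * (cmod (wave_integral UNIV y t))\<^sup>2" for k
    unfolding n power_mult_distrib[of "(2 * pi) ^ CARD('n)"] pow by (rule refl)
  then have "grad_sq U (y, t) = of_nat (card ((UNIV::'n set) \<rightarrow>\<^sub>E {0, 1::nat})) * ((4 * pi\<^sup>2) ^ CARD('n) * (cmod (wave_integral UNIV y t))\<^sup>2)"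
    unfolding grad_sq_def by (simp only: sum_constant)
  also have "card ((UNIV::'n set) \<rightarrow>\<^sub>E {0, 1::nat}) = 2 ^ CARD('n)"
    by (simp add: card_PiE numeral_2_eq_2)
  also have "of_nat (2 ^ CARD('n)) * ((4 * pi\<^sup>2) ^ CARD('n) * (cmod (wave_integral UNIV y t))\<^sup>2) = (2 * (4 * pi\<^sup>2)) ^ CARD('n) * (cmod (wave_integral UNIV y t))\<^sup>2"
    by (simp only: power_mult_distrib[of 2 "4 * pi\<^sup>2"] of_nat_power of_nat_numeral mult.assoc)
  finally show ?thesis by simp
qed

section \<open>The kernel of the cone weight\<close>

text \<open>The one-variable source of the Riesz multiplier: it is the factor \<open>\<xi>\<close>
  from differentiation times the kernel at \<open>r - \<xi>\<close>, rescaled by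
  \<open>r\<close>.\<close>

lemma powr_kernel_mult:
  assumes "0 < xi" "0 < (r::real)" "xi \<le> r" "0 < l"
  shows "lap_kernel l (r - xi) * xi = r powr l / l * (l * (\<bar>xi\<bar> / r) * (1 - \<bar>xi\<bar> / r) powr (l - 1))"
\<comment> \<open>At the endpoint both sides are 0 also for \<open>l \<le> 1\<close>:
  \<open>lap_kernel l 0 = 0\<close> on the left, and \<open>0 powr (l - 1) = 0\<close> on the
  right.\<close>
proof (cases "xi = r")
  case True
  then show ?thesis using assms by (simp add: lap_kernel_def)
next
  case False
  have "r - xi = r * (1 - xi / r)" using assms by (simp add: field_simps)
  then have "(r - xi) powr (l - 1) = (r * (1 - xi / r)) powr (l - 1)" by (rule arg_cong)
  also have "\<dots> = r powr (l - 1) * (1 - xi / r) powr (l - 1)"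
    using assms by (subst powr_mult) auto
  also have "r powr (l - 1) = r powr l / r" using assms by (simp add: powr_diff)
  finally show ?thesis using assms False by (simp add: lap_kernel_def)
qed

lemma mult_exp_neg_le:
  fixes a s :: real
  assumes "a > 0" "s \<ge> 0"
  shows "s * exp (- a * s) \<le> 1 / a"
proof -
  have "a * s \<le> exp (a * s)" using exp_ge_add_one_self[of "a * s"] by linarith
  then show ?thesis using assms by (simp add: exp_minus field_simps)
qed

context half_spectrum
begin

definition damped_symbol :: "real^'n \<Rightarrow> real^'n \<Rightarrow> real^'n \<Rightarrow> complex" where
  "damped_symbol x t \<xi> = F \<xi> * of_real (\<Prod>j\<in>UNIV. \<xi> $ j) * wave x t \<xi>"

lemma damped_symbol_continuous: "continuous_on UNIV (damped_symbol x t)"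
  unfolding damped_symbol_def[abs_def] wave_def by (intro continuous_intros cont)

lemma damped_symbol_integrable: "t \<in> pos_orthant \<Longrightarrow> integrable lborel (damped_symbol x t)"
  unfolding damped_symbol_def[abs_def] by (rule integrable_wave_integrand)

text \<open>Coordinatewise, \<open>s * exp (- a * s) \<le> 1 / a\<close> with
  \<open>a = 2 * pi * t $ i\<close>. This bound is what makes the convolution with a merely
  integrable kernel bounded and continuous.\<close>

lemma damped_symbol_bounded:
  assumes t: "t \<in> pos_orthant"
  shows "cmod (damped_symbol x t \<xi>) \<le> C * (\<Prod>i\<in>UNIV. 1 / (2 * pi * t $ i))"
proof (cases "\<xi> \<in> pos_orthant")
  case True
  then have pos: "0 < \<xi> $ i" for i by (rule pos_orthantD)
  have "cmod (of_real (\<Prod>j\<in>UNIV. \<xi> $ j) * wave x t \<xi>) = (\<Prod>i\<in>UNIV. \<xi> $ i * exp (- (2 * pi * t $ i) * (\<xi> $ i)))"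
    by (simp add: norm_mult norm_wave prod.distrib inner_vec_def sum_distrib_left sum_negf mult_ac abs_of_pos[OF pos] flip: exp_sum prod_norm)
  also have "\<dots> \<le> (\<Prod>i\<in>UNIV. 1 / (2 * pi * t $ i))"
    using t pos by (intro prod_mono conjI mult_exp_neg_le) (auto simp: pos_orthantD less_imp_le)
  finally have "cmod (F \<xi>) * cmod (of_real (\<Prod>j\<in>UNIV. \<xi> $ j) * wave x t \<xi>) \<le> C * (\<Prod>i\<in>UNIV. 1 / (2 * pi * t $ i))"
    using bound C_nonneg by (intro mult_mono) auto
  then show ?thesis by (simp add: damped_symbol_def norm_mult mult.assoc)
next
  case False
  have "0 \<le> (\<Prod>i\<in>UNIV. 1 / (2 * pi * t $ i))" using t by (intro prod_nonneg) (auto simp: pos_orthantD less_imp_le)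
  then show ?thesis using False C_nonneg by (simp add: damped_symbol_def supp)
qed

text \<open>The character of frequency \<open>x\<close> built into the symbol translates the
  transform; evaluated at \<open>x - y\<close> it is \<open>G\<close> at
  \<open>(y, t)\<close>.\<close>

lemma fourier_damped_symbol: "fourier (damped_symbol x t) \<eta> = wave_integral UNIV (x - \<eta>) t"
  unfolding fourier_def wave_integral_def damped_symbol_def wave_def
  by (intro Bochner_Integration.integral_cong refl)
     (simp add: inner_diff_left inner_commute algebra_simps flip: exp_add)

end

definition prod_kernel :: "real^'n \<Rightarrow> real^'n \<Rightarrow> real^'n \<Rightarrow> complex" where
  "prod_kernel lam t s = (\<Prod>i\<in>UNIV. of_real (lap_kernel (lam $ i) (s $ i)) * exp (- of_real (2 * pi * t $ i) * of_real (s $ i)))"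

text \<open>Coordinatewise the transform is \<open>Gamma (lam $ i) * w powr (- lam $ i)\<close> with
  \<open>w = 2 \<pi> (t_i + i \<eta>_i)\<close>, and frequency 0 gives the kernel itself. The
  exponents being real, the modulus of the complex power does not involve the argument of
  \<open>w\<close>, and Plancherel needs only the squared modulus.\<close>

lemma
  fixes lam t \<eta> :: "real^'n"
  assumes lam: "\<And>i. 0 < lam $ i" and t: "t \<in> pos_orthant"
  shows prod_kernel_integrable: "integrable lborel (prod_kernel lam t)"
    and cmod_fourier_prod_kernel: "(cmod (fourier (prod_kernel lam t) \<eta>))\<^sup>2 =
      (\<Prod>i\<in>UNIV. (Gamma (lam $ i))\<^sup>2 / (2 * pi) powr (2 * lam $ i)) * (\<Prod>i\<in>UNIV. 1 / cmod (Complex (t $ i) (\<eta> $ i)) powr (2 * lam $ i))"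
proof -
  define w where "w \<eta> i = of_real (2 * pi) * Complex (t $ i) (\<eta> $ i)" for \<eta> :: "real^'n" and i
  have Re_w: "Re (w \<eta> i) > 0" for \<eta> i using pos_orthantD[OF t, of i] by (simp add: w_def)
  have h: "has_bochner_integral lborel (\<lambda>s::real^'n. \<Prod>i\<in>UNIV. of_real (lap_kernel (lam $ i) (s $ i)) * exp (- w \<eta> i * of_real (s $ i)))
      (\<Prod>i\<in>UNIV. of_real (Gamma (lam $ i)) * w \<eta> i powr (- of_real (lam $ i)))" for \<eta>
    by (intro has_bochner_integral_prod_vec has_bochner_integral_lap_kernel lam Re_w)
  have "w 0 i = of_real (2 * pi * t $ i)" for i by (simp add: w_def complex_eq_iff)
  then have "prod_kernel lam t = (\<lambda>s. \<Prod>i\<in>UNIV. of_real (lap_kernel (lam $ i) (s $ i)) * exp (- w 0 i * of_real (s $ i)))"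
    by (simp add: prod_kernel_def[abs_def])
  then show "integrable lborel (prod_kernel lam t)" using h[of 0] by (simp add: has_bochner_integral_iff)
  have "fourier (prod_kernel lam t) \<eta> = (\<Prod>i\<in>UNIV. of_real (Gamma (lam $ i)) * w \<eta> i powr (- of_real (lam $ i)))"
  proof -
    have eq: "prod_kernel lam t s * exp (- 2 * of_real pi * \<i> * of_real (s \<bullet> \<eta>))
        = (\<Prod>i\<in>UNIV. of_real (lap_kernel (lam $ i) (s $ i)) * exp (- w \<eta> i * of_real (s $ i)))" for s
    proof -
      have "exp (- 2 * of_real pi * \<i> * of_real (s \<bullet> \<eta>)) = (\<Prod>i\<in>UNIV. exp (- 2 * of_real pi * \<i> * of_real (s $ i * \<eta> $ i)))"
        by (simp add: inner_vec_def sum_distrib_left sum_negf flip: exp_sum)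
      then have "prod_kernel lam t s * exp (- 2 * of_real pi * \<i> * of_real (s \<bullet> \<eta>)) =
        (\<Prod>i\<in>UNIV. of_real (lap_kernel (lam $ i) (s $ i)) * (exp (- of_real (2 * pi * t $ i) * of_real (s $ i)) * exp (- 2 * of_real pi * \<i> * of_real (s $ i * \<eta> $ i))))"
        by (simp only: prod_kernel_def prod.distrib mult.assoc)
      also have "\<dots> = (\<Prod>i\<in>UNIV. of_real (lap_kernel (lam $ i) (s $ i)) * exp (- w \<eta> i * of_real (s $ i)))"
        unfolding exp_add[symmetric]
        by (intro prod.cong refl arg_cong2[where f = "(*)"] arg_cong[where f = exp])
           (simp add: w_def complex_eq_iff algebra_simps)
      finally show ?thesis .
    qed
    show ?thesis using h[of \<eta>] unfolding fourier_def eq has_bochner_integral_iff by blast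
  qed
  also have "(cmod \<dots>)\<^sup>2 = (\<Prod>i\<in>UNIV. (Gamma (lam $ i))\<^sup>2 / (2 * pi) powr (2 * lam $ i) * (1 / cmod (Complex (t $ i) (\<eta> $ i)) powr (2 * lam $ i)))"
    unfolding prod_norm[symmetric] prod_power_distrib
  proof (intro prod.cong refl)
    fix i
    have nz: "w \<eta> i \<noteq> 0" using Re_w[of \<eta> i] by auto
    have "cmod (w \<eta> i powr (- of_real (lam $ i))) = cmod (w \<eta> i) powr (- (lam $ i))"
      using cmod_powr_of_real[OF nz, of "- (lam $ i)"] by simp
    also have "cmod (w \<eta> i) = 2 * pi * cmod (Complex (t $ i) (\<eta> $ i))" by (simp add: w_def norm_mult)
    finally have "(cmod (w \<eta> i powr (- of_real (lam $ i))))\<^sup>2 = ((2 * pi * cmod (Complex (t $ i) (\<eta> $ i))) powr (- (lam $ i)))\<^sup>2"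
      by simp
    also have "\<dots> = (2 * pi * cmod (Complex (t $ i) (\<eta> $ i))) powr (- (2 * lam $ i))"
      by (simp add: power2_eq_square flip: powr_add)
    also have "\<dots> = 1 / (2 * pi) powr (2 * lam $ i) * (1 / cmod (Complex (t $ i) (\<eta> $ i)) powr (2 * lam $ i))"
      by (simp add: powr_minus_divide powr_mult)
    finally show "(cmod (of_real (Gamma (lam $ i)) * w \<eta> i powr (- of_real (lam $ i))))\<^sup>2
      = (Gamma (lam $ i))\<^sup>2 / (2 * pi) powr (2 * lam $ i) * (1 / cmod (Complex (t $ i) (\<eta> $ i)) powr (2 * lam $ i))"
      by (simp add: norm_mult power_mult_distrib)
  qed
  finally show "(cmod (fourier (prod_kernel lam t) \<eta>))\<^sup>2 =
      (\<Prod>i\<in>UNIV. (Gamma (lam $ i))\<^sup>2 / (2 * pi) powr (2 * lam $ i)) * (\<Prod>i\<in>UNIV. 1 / cmod (Complex (t $ i) (\<eta> $ i)) powr (2 * lam $ i))"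
    unfolding prod.distrib .
qed

lemma prod_kernel_measurable [measurable]: "prod_kernel lam t \<in> borel_measurable borel"
  unfolding prod_kernel_def[abs_def] by measurable

context half_spectrum
begin

text \<open>The mean \<open>tau\<close> with the abstract \<open>F\<close> in the place of the
  Fourier transform.\<close>

definition riesz_mean :: "real^'n \<Rightarrow> real^'n \<Rightarrow> real^'n \<Rightarrow> complex" where
  "riesz_mean lam R x = (LINT \<xi>:cbox (- R) R|lborel.
      of_real (\<Prod>i\<in>UNIV. lam $ i * (\<bar>\<xi> $ i\<bar> / R $ i) * (1 - \<bar>\<xi> $ i\<bar> / R $ i) powr (lam $ i - 1))
      * F \<xi> * exp (2 * of_real pi * \<i> * of_real (x \<bullet> \<xi>)))"

text \<open>The dampings at \<open>R - \<xi>\<close> and at \<open>\<xi>\<close> multiply to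
  \<open>exp (- 2 * pi * (t \<bullet> R))\<close>, free of \<open>\<xi>\<close>, so \<open>t\<close>
  separates from the Riesz mean. The supports of the two factors confine \<open>\<xi>\<close> to
  \<open>0 < \<xi>_i < R_i\<close>: that is the part of the box where \<open>F\<close> lives, and it
  is empty unless \<open>R\<close> lies in the orthant.\<close>

lemma convol_eq_riesz_mean:
  assumes lam: "\<And>i. 0 < lam $ i" and t: "t \<in> pos_orthant"
  shows "convol (prod_kernel lam t) (damped_symbol x t) R = (if R \<in> pos_orthant
    then of_real (exp (- 2 * pi * (t \<bullet> R)) * (\<Prod>i\<in>UNIV. R $ i powr lam $ i / lam $ i)) * riesz_mean lam R x else 0)"
proof -
  have [measurable]: "damped_symbol x t \<in> borel_measurable borel" unfolding damped_symbol_def[abs_def] by measurable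
  have conv: "convol (prod_kernel lam t) (damped_symbol x t) R = (\<integral>\<xi>. prod_kernel lam t (R - \<xi>) * damped_symbol x t \<xi> \<partial>lborel)"
    by (rule convol_commute) measurable
  have vz: "prod_kernel lam t s = 0" if "s $ i \<le> 0" for s i
    unfolding prod_kernel_def using that by (intro prod_zero) (auto intro!: exI[of _ i] simp: lap_kernel_def)
  show ?thesis
  proof (cases "R \<in> pos_orthant")
    case False
    then obtain i where i: "R $ i \<le> 0" by (auto simp: pos_orthant_def not_less)
    have z: "prod_kernel lam t (R - \<xi>) * damped_symbol x t \<xi> = 0" for \<xi>
    proof (cases "\<xi> \<in> pos_orthant")
      case True
      then show ?thesis using vz[of "R - \<xi>" i] i pos_orthantD[OF True, of i] by simp
    qed (simp add: damped_symbol_def supp)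
    show ?thesis using False by (simp add: conv z del: mult_eq_0_iff)
  next
    case True
    then have R: "0 < R $ i" for i by (rule pos_orthantD)
    define c where "c = exp (- 2 * pi * (t \<bullet> R)) * (\<Prod>i\<in>UNIV. R $ i powr lam $ i / lam $ i)"
    have "prod_kernel lam t (R - \<xi>) * damped_symbol x t \<xi> = of_real c * (indicat_real (cbox (- R) R) \<xi> *\<^sub>R
        (of_real (\<Prod>i\<in>UNIV. lam $ i * (\<bar>\<xi> $ i\<bar> / R $ i) * (1 - \<bar>\<xi> $ i\<bar> / R $ i) powr (lam $ i - 1))
          * F \<xi> * exp (2 * of_real pi * \<i> * of_real (x \<bullet> \<xi>))))" (is "_ = _ * (_ *\<^sub>R (of_real ?p * _ * _))") for \<xi>
    proof (cases "\<xi> \<in> pos_orthant")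
      case False
      then show ?thesis by (simp add: damped_symbol_def supp)
    next
      case xi: True
      then have pos: "0 < \<xi> $ i" for i by (rule pos_orthantD)
      show ?thesis
      proof (cases "\<xi> \<in> cbox (- R) R")
        case False
        then obtain i where "\<not> (- R $ i \<le> \<xi> $ i \<and> \<xi> $ i \<le> R $ i)"
          by (auto simp: mem_box_cart)
        then have "R $ i < \<xi> $ i" using pos[of i] R[of i] by linarith
        then have "(R - \<xi>) $ i \<le> 0" by simp
        from vz[OF this] show ?thesis using False by simp
      next
        case True
        then have le: "\<xi> $ i \<le> R $ i" for i by (simp add: mem_box_cart)
        have e1: "prod_kernel lam t (R - \<xi>) = of_real ((\<Prod>i\<in>UNIV. lap_kernel (lam $ i) (R $ i - \<xi> $ i)) * exp (- 2 * pi * (t \<bullet> (R - \<xi>))))"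
          by (simp add: prod_kernel_def prod.distrib inner_vec_def sum_distrib_left sum_negf algebra_simps sum_subtractf sum.distrib flip: exp_sum exp_of_real)
        have e2: "(\<Prod>i\<in>UNIV. lap_kernel (lam $ i) (R $ i - \<xi> $ i)) * (\<Prod>i\<in>UNIV. \<xi> $ i)
            = (\<Prod>i\<in>UNIV. R $ i powr lam $ i / lam $ i) * ?p"
          unfolding prod.distrib[symmetric]
          by (intro prod.cong refl powr_kernel_mult pos R le lam)
        have e3: "wave x t \<xi> = of_real (exp (- 2 * pi * (t \<bullet> \<xi>))) * exp (2 * of_real pi * \<i> * of_real (x \<bullet> \<xi>))"
          unfolding wave_def exp_of_real[symmetric] exp_add by (rule refl)
        have e4: "exp (- 2 * pi * (t \<bullet> (R - \<xi>))) * exp (- 2 * pi * (t \<bullet> \<xi>)) = exp (- 2 * pi * (t \<bullet> R))"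
          by (simp add: inner_diff_right algebra_simps flip: exp_add)
        have "prod_kernel lam t (R - \<xi>) * damped_symbol x t \<xi> = of_real (((\<Prod>i\<in>UNIV. lap_kernel (lam $ i) (R $ i - \<xi> $ i)) * (\<Prod>i\<in>UNIV. \<xi> $ i))
           * (exp (- 2 * pi * (t \<bullet> (R - \<xi>))) * exp (- 2 * pi * (t \<bullet> \<xi>)))) * F \<xi> * exp (2 * of_real pi * \<i> * of_real (x \<bullet> \<xi>))"
          unfolding e1 damped_symbol_def e3 by (simp only: of_real_mult mult_ac)
        also have "\<dots> = of_real c * (of_real ?p * F \<xi> * exp (2 * of_real pi * \<i> * of_real (x \<bullet> \<xi>)))"
          unfolding e2 e4 c_def by (simp only: of_real_mult mult_ac)
        finally show ?thesis using True by simp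
      qed
    qed
    then have "convol (prod_kernel lam t) (damped_symbol x t) R = of_real c * riesz_mean lam R x"
      unfolding conv riesz_mean_def set_lebesgue_integral_def by (simp only: integral_mult_right_zero)
    then show ?thesis using True by (simp add: c_def)
  qed
qed

end

section \<open>The integral identity\<close>

text \<open>A product of Gamma integrals of order \<open>2 * lam $ i + 1\<close>, since the power
  \<open>2 * lam $ i\<close> of \<open>t $ i\<close> is \<open>lap_kernel (2 * lam $ i + 1)\<close>
  on the positive axis.\<close>

lemma nn_integral_orthant_powr_exp:
  fixes lam R :: "real^'n"
  assumes lam: "\<And>i. 0 < lam $ i" and R: "R \<in> pos_orthant"
  shows "(\<integral>\<^sup>+t. ennreal (indicator pos_orthant t * ((\<Prod>i\<in>UNIV. t $ i powr (2 * lam $ i)) * exp (- 4 * pi * (t \<bullet> R)))) \<partial>lborel)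
    = ennreal (\<Prod>i\<in>UNIV. Gamma (2 * lam $ i + 1) / (4 * pi * R $ i) powr (2 * lam $ i + 1))"
proof -
  have pos: "0 < 2 * lam $ i + 1" "0 < 4 * pi * R $ i" for i
    using lam[of i] pos_orthantD[OF R, of i] by simp_all
  have eq: "(\<Prod>i\<in>UNIV. lap_kernel (2 * lam $ i + 1) (t $ i) * exp (- (4 * pi * R $ i) * (t $ i)))
      = indicator pos_orthant t * ((\<Prod>i\<in>UNIV. t $ i powr (2 * lam $ i)) * exp (- 4 * pi * (t \<bullet> R)))" for t :: "real^'n"
  proof (cases "t \<in> pos_orthant")
    case True
    have "(\<Prod>i\<in>UNIV. exp (- (4 * pi * R $ i) * (t $ i))) = exp (- 4 * pi * (t \<bullet> R))"
      by (simp add: inner_vec_def sum_distrib_left sum_negf mult_ac flip: exp_sum)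
    then show ?thesis using pos_orthantD[OF True] True by (simp add: prod.distrib lap_kernel_def)
  next
    case False
    then obtain i where "\<not> 0 < t $ i" by (auto simp: pos_orthant_def)
    then show ?thesis using False by (auto simp: lap_kernel_def intro!: prod_zero exI[of _ i])
  qed
  have "(\<integral>\<^sup>+t. (\<Prod>i\<in>UNIV. ennreal (lap_kernel (2 * lam $ i + 1) (t $ i) * exp (- (4 * pi * R $ i) * (t $ i)))) \<partial>(lborel :: (real^'n) measure))
    = (\<Prod>i\<in>UNIV. ennreal (Gamma (2 * lam $ i + 1) / (4 * pi * R $ i) powr (2 * lam $ i + 1)))"
    by (subst nn_integral_prod_vec, measurable) (simp only: nn_integral_lap_kernel[OF pos])
  moreover have "Gamma (2 * lam $ i + 1) \<ge> 0" for i using Gamma_real_pos[OF pos(1)[of i]] by simp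
  ultimately show ?thesis
    by (simp only: eq[symmetric] prod_ennreal mult_nonneg_nonneg lap_kernel_nonneg exp_ge_zero divide_nonneg_nonneg powr_ge_zero)
qed

text \<open>The constant in the squared modulus of the Fourier transform of
  \<open>prod_kernel\<close>.\<close>

definition kernel_const :: "real^'n \<Rightarrow> real" where
  "kernel_const lam = (\<Prod>i\<in>UNIV. (Gamma (lam $ i))\<^sup>2 / (2 * pi) powr (2 * lam $ i))"

text \<open>The Gamma factors and powers of \<open>4 * pi\<close> come from the integration in
  \<open>t\<close>, the squares of \<open>lam $ i\<close> from squaring
  \<open>R $ i powr lam $ i / lam $ i\<close>.\<close>

definition riesz_const :: "real^'n \<Rightarrow> real" where
  "riesz_const lam = (\<Prod>i\<in>UNIV. Gamma (2 * lam $ i + 1) / ((4 * pi) powr (2 * lam $ i + 1) * (lam $ i)\<^sup>2))"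

lemma weight_const_pos:
  assumes lam: "\<And>i. 0 < lam $ i"
  shows "0 < kernel_const lam" "0 < riesz_const lam"
proof -
  have "0 < Gamma (lam $ i)" "0 < Gamma (2 * lam $ i + 1)" "lam $ i \<noteq> 0" for i
    using lam[of i] by (auto intro: Gamma_real_pos)
  then show "0 < kernel_const lam" "0 < riesz_const lam"
    unfolding kernel_const_def riesz_const_def by (auto intro!: prod_pos divide_pos_pos mult_pos_pos simp: less_imp_neq[symmetric])
qed

context half_spectrum
begin

definition riesz_mean_orthant :: "real^'n \<Rightarrow> real^'n \<Rightarrow> real^'n \<Rightarrow> complex" where
  "riesz_mean_orthant lam x R = (if R \<in> pos_orthant then riesz_mean lam R x else 0)"

text \<open>The domain of integration of the Riesz mean moves with \<open>R\<close>, so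
  measurability is read off from the convolution at height \<open>t = 1\<close>: divide by the
  explicit factor, which is nonzero on the orthant. Elsewhere the numerator, and with it the
  quotient, is 0.\<close>

lemma riesz_mean_orthant_measurable:
  assumes lam: "\<And>i. 0 < lam $ i"
  shows "riesz_mean_orthant lam x \<in> borel_measurable borel"
proof -
  have one: "(1::real^'n) \<in> pos_orthant" by (simp add: pos_orthant_def)
  have [measurable]: "convol (prod_kernel lam 1) (damped_symbol x 1) \<in> borel_measurable borel"
    by (rule borel_measurable_integrable[OF integrable_convol, simplified])
       (intro prod_kernel_integrable damped_symbol_integrable one lam)+
  have "riesz_mean_orthant lam x R = convol (prod_kernel lam 1) (damped_symbol x 1) R /
      of_real (exp (- 2 * pi * (1 \<bullet> R)) * (\<Prod>i\<in>UNIV. R $ i powr lam $ i / lam $ i))" for R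
  proof (cases "R \<in> pos_orthant")
    case True
    then have "exp (- 2 * pi * (1 \<bullet> R)) * (\<Prod>i\<in>UNIV. R $ i powr lam $ i / lam $ i) \<noteq> 0"
      using lam less_imp_neq[OF pos_orthantD[OF True]] less_imp_neq[OF lam] by auto
    then show ?thesis using True convol_eq_riesz_mean[OF lam one, of x R] by (simp add: riesz_mean_orthant_def del: of_real_mult of_real_prod)
  qed (simp add: riesz_mean_orthant_def convol_eq_riesz_mean[OF lam one])
  then have "riesz_mean_orthant lam x = (\<lambda>R. convol (prod_kernel lam 1) (damped_symbol x 1) R /
      of_real (exp (- 2 * pi * (1 \<bullet> R)) * (\<Prod>i\<in>UNIV. R $ i powr lam $ i / lam $ i)))" by blast
  then show ?thesis by simp
qed

text \<open>Plancherel at a fixed height, with the frequency taken to be \<open>x - y\<close>. This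
  centres the weight at \<open>x\<close> and makes the second factor of the transform equal to
  \<open>G (y, t)\<close>.\<close>

lemma slice_identity:
  assumes lam: "\<And>i. 0 < lam $ i" and t: "t \<in> pos_orthant"
  shows "(\<integral>\<^sup>+y. ennreal (kernel_const lam * (\<Prod>i\<in>UNIV. 1 / cmod (Complex (t $ i) (x $ i - y $ i)) powr (2 * lam $ i)) * (cmod (wave_integral UNIV y t))\<^sup>2) \<partial>lborel)
    = (\<integral>\<^sup>+R. ennreal (exp (- 4 * pi * (t \<bullet> R)) * (\<Prod>i\<in>UNIV. R $ i powr (2 * lam $ i) / (lam $ i)\<^sup>2) * (cmod (riesz_mean_orthant lam x R))\<^sup>2) \<partial>lborel)"
proof -
  let ?W = "convol (prod_kernel lam t) (damped_symbol x t)"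
  have g: "integrable lborel (damped_symbol x t)" by (rule damped_symbol_integrable[OF t])
  have K: "integrable lborel (prod_kernel lam t)" by (rule prod_kernel_integrable[OF lam t])
  have W: "integrable lborel ?W" by (rule integrable_convol[OF K g])
  have "(cmod (fourier ?W (x - y)))\<^sup>2 = kernel_const lam * (\<Prod>i\<in>UNIV. 1 / cmod (Complex (t $ i) (x $ i - y $ i)) powr (2 * lam $ i)) * (cmod (wave_integral UNIV y t))\<^sup>2" for y
    using cmod_fourier_prod_kernel[OF lam t, of "x - y"]
    by (simp add: fourier_convol[OF K g] fourier_damped_symbol norm_mult power_mult_distrib kernel_const_def)
  then have "(\<integral>\<^sup>+y. ennreal (kernel_const lam * (\<Prod>i\<in>UNIV. 1 / cmod (Complex (t $ i) (x $ i - y $ i)) powr (2 * lam $ i)) * (cmod (wave_integral UNIV y t))\<^sup>2) \<partial>lborel)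
      = (\<integral>\<^sup>+y. ennreal ((cmod (fourier ?W (x - y)))\<^sup>2) \<partial>lborel)" by simp
  also have "\<dots> = (\<integral>\<^sup>+y. ennreal ((cmod (fourier ?W y))\<^sup>2) \<partial>lborel)"
    using fourier_measurable[OF W] by (intro nn_integral_reflect_shift[of "\<lambda>y. ennreal ((cmod (fourier ?W y))\<^sup>2)"]) measurable
  also have "\<dots> = (\<integral>\<^sup>+R. ennreal ((cmod (?W R))\<^sup>2) \<partial>lborel)"
    by (rule plancherel[OF W continuous_on_convol[OF K damped_symbol_continuous damped_symbol_bounded[OF t]] convol_bounded[OF K _ damped_symbol_bounded[OF t]]])
       (use g in auto)
  also have "(\<lambda>R. (cmod (?W R))\<^sup>2) = (\<lambda>R. exp (- 4 * pi * (t \<bullet> R)) * (\<Prod>i\<in>UNIV. R $ i powr (2 * lam $ i) / (lam $ i)\<^sup>2) * (cmod (riesz_mean_orthant lam x R))\<^sup>2)"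
  proof
    fix R
    have 1: "(exp (- 2 * pi * (t \<bullet> R)))\<^sup>2 = exp (- 4 * pi * (t \<bullet> R))"
      by (simp add: power2_eq_square flip: exp_add)
    have 2: "(\<Prod>i\<in>UNIV. R $ i powr lam $ i / lam $ i)\<^sup>2 = (\<Prod>i\<in>UNIV. R $ i powr (2 * lam $ i) / (lam $ i)\<^sup>2)"
      unfolding prod_power_distrib
      by (intro prod.cong refl) (simp add: power_divide power2_eq_square powr_add[symmetric])
    show "(cmod (?W R))\<^sup>2 = exp (- 4 * pi * (t \<bullet> R)) * (\<Prod>i\<in>UNIV. R $ i powr (2 * lam $ i) / (lam $ i)\<^sup>2) * (cmod (riesz_mean_orthant lam x R))\<^sup>2"
      unfolding 1[symmetric] 2[symmetric]
      by (simp add: convol_eq_riesz_mean[OF lam t] riesz_mean_orthant_def norm_mult power_mult_distrib del: of_real_mult of_real_prod)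
  qed
  finally show ?thesis .
qed

text \<open>The square of \<open>g_star\<close> up to constants, with the modulus of
  \<open>t_i + i (x_i - y_i)\<close> for \<open>t_i + \<bar>x_i - y_i\<bar>\<close>, and
  \<open>G\<close> for the whole family of mixed derivatives.\<close>

definition cone_integral :: "real^'n \<Rightarrow> real^'n \<Rightarrow> ennreal" where
  "cone_integral lam x = (\<integral>\<^sup>+p\<in>UNIV \<times> pos_orthant. (case p of (y, t) \<Rightarrow>
     ennreal ((\<Prod>i\<in>UNIV. (t $ i / cmod (Complex (t $ i) (x $ i - y $ i))) powr (2 * lam $ i)) * (cmod (wave_integral UNIV y t))\<^sup>2)) \<partial>lborel)"

text \<open>The slice identity is multiplied by the power \<open>2 \<lambda>\<close> of
  \<open>t\<close> and integrated over the orthant. All integrands are nonnegative, so Tonelli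
  brings the \<open>t\<close> integral inside without any finiteness.\<close>

lemma cone_integral_identity:
  assumes lam: "\<And>i. 0 < lam $ i"
  shows "ennreal (kernel_const lam) * cone_integral lam x = ennreal (riesz_const lam) *
    (\<integral>\<^sup>+R\<in>pos_orthant. ennreal ((cmod (riesz_mean lam R x))\<^sup>2 / (\<Prod>i\<in>UNIV. R $ i)) \<partial>lborel)"
proof -
  have [measurable]: "riesz_mean_orthant lam x \<in> borel_measurable borel" by (rule riesz_mean_orthant_measurable[OF lam])
  define P where "P t = (\<Prod>i\<in>UNIV. t $ i powr (2 * lam $ i))" for t :: "real^'n"
  have [measurable]: "P \<in> borel_measurable borel" unfolding P_def[abs_def] by measurable
  have P0: "P t \<ge> 0" for t unfolding P_def by (intro prod_nonneg) auto
  define Q where "Q t y = (\<Prod>i\<in>UNIV. 1 / cmod (Complex (t $ i) (x $ i - y $ i)) powr (2 * lam $ i)) * (cmod (wave_integral UNIV y t))\<^sup>2" for t y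
  \<comment> \<open>Spelling out the modulus as a square root exposes joint measurability in
    \<open>y\<close> and \<open>t\<close>.\<close>
  have Q_alt: "Q t y = (\<Prod>i\<in>UNIV. 1 / sqrt ((t $ i)\<^sup>2 + (x $ i - y $ i)\<^sup>2) powr (2 * lam $ i)) * (cmod (wave_integral UNIV y t))\<^sup>2" for t y
    unfolding Q_def complex_norm by simp
  have Q0: "Q t y \<ge> 0" for t y unfolding Q_def by (intro mult_nonneg_nonneg prod_nonneg) auto
  have [measurable]: "(\<lambda>(y, t). Q t y) \<in> borel_measurable (borel \<Otimes>\<^sub>M borel)"
    unfolding Q_alt by measurable
  define S where "S R = (\<Prod>i\<in>UNIV. R $ i powr (2 * lam $ i) / (lam $ i)\<^sup>2) * (cmod (riesz_mean_orthant lam x R))\<^sup>2" for R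
  have [measurable]: "S \<in> borel_measurable borel" unfolding S_def[abs_def] by measurable
  have S0: "S R \<ge> 0" for R unfolding S_def by (intro mult_nonneg_nonneg prod_nonneg) auto
  note kap = weight_const_pos[OF lam, simplified]
  have PQ: "(\<Prod>i\<in>UNIV. (t $ i / cmod (Complex (t $ i) (x $ i - y $ i))) powr (2 * lam $ i)) * (cmod (wave_integral UNIV y t))\<^sup>2 = P t * Q t y"
    if t: "t \<in> pos_orthant" for y t
  proof -
    have "(\<Prod>i\<in>UNIV. (t $ i / cmod (Complex (t $ i) (x $ i - y $ i))) powr (2 * lam $ i)) =
      (\<Prod>i\<in>UNIV. t $ i powr (2 * lam $ i) * (1 / cmod (Complex (t $ i) (x $ i - y $ i)) powr (2 * lam $ i)))"
      using pos_orthantD[OF t] by (intro prod.cong refl) (simp add: powr_divide less_imp_le)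
    then show ?thesis
      unfolding P_def Q_def prod.distrib by (simp only: mult.assoc)
  qed
  have "cone_integral lam x = (\<integral>\<^sup>+p. (case p of (y, t) \<Rightarrow> ennreal (indicator pos_orthant t * (P t * Q t y))) \<partial>(lborel \<Otimes>\<^sub>M lborel))"
    unfolding cone_integral_def lborel_prod
  proof (rule nn_integral_cong)
    fix p :: "(real^'n) \<times> (real^'n)"
    obtain y t where p: "p = (y, t)" by (cases p)
    show "(case p of (y, t) \<Rightarrow> ennreal ((\<Prod>i\<in>UNIV. (t $ i / cmod (Complex (t $ i) (x $ i - y $ i))) powr (2 * lam $ i)) * (cmod (wave_integral UNIV y t))\<^sup>2))
        * indicator (UNIV \<times> pos_orthant) p = (case p of (y, t) \<Rightarrow> ennreal (indicator pos_orthant t * (P t * Q t y)))"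
      by (cases "t \<in> pos_orthant") (simp_all add: p PQ)
  qed
  also have "\<dots> = (\<integral>\<^sup>+t. (\<integral>\<^sup>+y. ennreal (indicator pos_orthant t * (P t * Q t y)) \<partial>lborel) \<partial>lborel)"
    by (subst lborel_pair.nn_integral_snd[symmetric]) auto
  finally have "ennreal (kernel_const lam) * cone_integral lam x
      = (\<integral>\<^sup>+t. (\<integral>\<^sup>+y. ennreal (kernel_const lam) * ennreal (indicator pos_orthant t * (P t * Q t y)) \<partial>lborel) \<partial>lborel)"
    by (simp add: nn_integral_cmult)
  also have "\<dots> = (\<integral>\<^sup>+t. (\<integral>\<^sup>+R. ennreal (indicator pos_orthant t * (P t * exp (- 4 * pi * (t \<bullet> R)))) * ennreal (S R) \<partial>lborel) \<partial>lborel)"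
  proof (rule nn_integral_cong)
    fix t :: "real^'n"
    show "(\<integral>\<^sup>+y. ennreal (kernel_const lam) * ennreal (indicator pos_orthant t * (P t * Q t y)) \<partial>lborel)
      = (\<integral>\<^sup>+R. ennreal (indicator pos_orthant t * (P t * exp (- 4 * pi * (t \<bullet> R)))) * ennreal (S R) \<partial>lborel)"
    proof (cases "t \<in> pos_orthant")
      case True
      have "(\<integral>\<^sup>+y. ennreal (kernel_const lam) * ennreal (indicator pos_orthant t * (P t * Q t y)) \<partial>lborel)
          = (\<integral>\<^sup>+y. ennreal (P t) * ennreal (kernel_const lam * Q t y) \<partial>lborel)"
        using True P0 Q0 kap by (simp add: mult_ac less_imp_le flip: ennreal_mult)
      also have "\<dots> = ennreal (P t) * (\<integral>\<^sup>+y. ennreal (kernel_const lam * Q t y) \<partial>lborel)"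
        by (rule nn_integral_cmult) measurable
      also have "(\<integral>\<^sup>+y. ennreal (kernel_const lam * Q t y) \<partial>lborel) = (\<integral>\<^sup>+R. ennreal (exp (- 4 * pi * (t \<bullet> R)) * S R) \<partial>lborel)"
        using slice_identity[OF lam True, of x] by (simp add: Q_def S_def mult.assoc)
      also have "ennreal (P t) * \<dots> = (\<integral>\<^sup>+R. ennreal (P t) * ennreal (exp (- 4 * pi * (t \<bullet> R)) * S R) \<partial>lborel)"
        by (rule nn_integral_cmult[symmetric]) measurable
      also have "\<dots> = (\<integral>\<^sup>+R. ennreal (indicator pos_orthant t * (P t * exp (- 4 * pi * (t \<bullet> R)))) * ennreal (S R) \<partial>lborel)"
        using True P0 S0 by (simp add: mult.assoc flip: ennreal_mult)
      finally show ?thesis .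
    qed simp
  qed
  also have "\<dots> = (\<integral>\<^sup>+R. (\<integral>\<^sup>+t. ennreal (indicator pos_orthant t * (P t * exp (- 4 * pi * (t \<bullet> R)))) * ennreal (S R) \<partial>lborel) \<partial>lborel)"
    by (rule lborel_pair.Fubini') measurable
  also have "\<dots> = (\<integral>\<^sup>+R. ennreal (riesz_const lam) * (ennreal ((cmod (riesz_mean lam R x))\<^sup>2 / (\<Prod>i\<in>UNIV. R $ i)) * indicator pos_orthant R) \<partial>lborel)"
  proof (rule nn_integral_cong)
    fix R :: "real^'n"
    have "(\<integral>\<^sup>+t. ennreal (indicator pos_orthant t * (P t * exp (- 4 * pi * (t \<bullet> R)))) * ennreal (S R) \<partial>lborel)
      = (\<integral>\<^sup>+t. ennreal (indicator pos_orthant t * (P t * exp (- 4 * pi * (t \<bullet> R)))) \<partial>lborel) * ennreal (S R)"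
      by (rule nn_integral_multc) measurable
    also have "\<dots> = ennreal (riesz_const lam) * (ennreal ((cmod (riesz_mean lam R x))\<^sup>2 / (\<Prod>i\<in>UNIV. R $ i)) * indicator pos_orthant R)"
    proof (cases "R \<in> pos_orthant")
      case True
      note R = pos_orthantD[OF True]
      have l: "Gamma (2 * lam $ i + 1) \<ge> 0" for i
        using Gamma_real_pos[of "2 * lam $ i + 1"] lam[of i] by simp
      \<comment> \<open>The powers of \<open>R $ i\<close> from the \<open>t\<close> integral and
        from the squared convolution factor cancel up to \<open>1 / R $ i\<close>, the density in
        \<open>h_fun\<close>.\<close>
      have "(\<Prod>i\<in>UNIV. Gamma (2 * lam $ i + 1) / (4 * pi * R $ i) powr (2 * lam $ i + 1)) * (\<Prod>i\<in>UNIV. R $ i powr (2 * lam $ i) / (lam $ i)\<^sup>2)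
        = (\<Prod>i\<in>UNIV. Gamma (2 * lam $ i + 1) / ((4 * pi) powr (2 * lam $ i + 1) * (lam $ i)\<^sup>2)) * (\<Prod>i\<in>UNIV. 1 / R $ i)"
        unfolding prod.distrib[symmetric]
      proof (rule prod.cong[OF refl])
        fix i
        have "(4 * pi * R $ i) powr (2 * lam $ i + 1) = (4 * pi) powr (2 * lam $ i + 1) * (R $ i powr (2 * lam $ i) * R $ i)"
          using R[of i] by (simp add: powr_mult powr_add)
        then show "Gamma (2 * lam $ i + 1) / (4 * pi * R $ i) powr (2 * lam $ i + 1) * (R $ i powr (2 * lam $ i) / (lam $ i)\<^sup>2)
          = Gamma (2 * lam $ i + 1) / ((4 * pi) powr (2 * lam $ i + 1) * (lam $ i)\<^sup>2) * (1 / R $ i)"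
          using R[of i] by simp
      qed
      then have "(\<Prod>i\<in>UNIV. Gamma (2 * lam $ i + 1) / (4 * pi * R $ i) powr (2 * lam $ i + 1)) * S R
         = riesz_const lam * ((cmod (riesz_mean lam R x))\<^sup>2 / (\<Prod>i\<in>UNIV. R $ i))"
        unfolding S_def riesz_const_def mult.assoc[symmetric] using True
        by (simp add: riesz_mean_orthant_def prod_dividef)
      moreover have "0 \<le> (\<Prod>i\<in>UNIV. Gamma (2 * lam $ i + 1) / (4 * pi * R $ i) powr (2 * lam $ i + 1))"
        using l by (intro prod_nonneg) auto
      ultimately show ?thesis
        unfolding P_def nn_integral_orthant_powr_exp[OF lam True]
        using True S0 kap by (simp add: prod_nonneg R less_imp_le flip: ennreal_mult)
    qed (simp add: S_def riesz_mean_orthant_def)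
    finally show "(\<integral>\<^sup>+t. ennreal (indicator pos_orthant t * (P t * exp (- 4 * pi * (t \<bullet> R)))) * ennreal (S R) \<partial>lborel) = \<dots>" .
  qed
  also have "\<dots> = ennreal (riesz_const lam) * (\<integral>\<^sup>+R\<in>pos_orthant. ennreal ((cmod (riesz_mean lam R x))\<^sup>2 / (\<Prod>i\<in>UNIV. R $ i)) \<partial>lborel)"
  proof (rule nn_integral_cmult)
    \<comment> \<open>Measurability is known for the extension by zero, so the indicator is absorbed
      into it.\<close>
    have "(\<lambda>R. ennreal ((cmod (riesz_mean lam R x))\<^sup>2 / (\<Prod>i\<in>UNIV. R $ i)) * indicator pos_orthant R)
      = (\<lambda>R. ennreal ((cmod (riesz_mean_orthant lam x R))\<^sup>2 / (\<Prod>i\<in>UNIV. R $ i)))"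
      by (auto simp: riesz_mean_orthant_def indicator_def)
    then show "(\<lambda>R. ennreal ((cmod (riesz_mean lam R x))\<^sup>2 / (\<Prod>i\<in>UNIV. R $ i)) * indicator pos_orthant R) \<in> borel_measurable lborel"
      by simp
  qed
  finally show ?thesis .
qed

end

section \<open>From the exact identity to the two-sided estimate\<close>

lemma ennsqrt_mono: "a \<le> b \<Longrightarrow> ennsqrt a \<le> ennsqrt b"
  by (cases a; cases b) (auto simp: ennsqrt_def top_unique intro!: ennreal_leI)

lemma ennsqrt_cmult:
  assumes "0 < c"
  shows "ennsqrt (ennreal c * a) = ennreal (sqrt c) * ennsqrt a"
proof (cases a)
  case (real r)
  then show ?thesis using assms by (simp add: ennsqrt_def real_sqrt_mult flip: ennreal_mult)
next
  case top
  then show ?thesis using assms by (simp add: ennsqrt_def ennreal_mult_top)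
qed

context half_spectrum
begin

text \<open>On the orthant the absolute values in \<open>abel_factor\<close> disappear and the
  integrand is a \<open>wave\<close>; off the orthant \<open>F\<close> annihilates both
  integrands.\<close>

lemma poisson_integral_eq_wave_integral:
  assumes "integrable lborel f" "F = fourier f" "t \<in> pos_orthant"
  shows "poisson_integral f (y, t) = wave_integral {} y t"
proof -
  have "F \<xi> * of_real (abel_factor t \<xi>) * exp (2 * of_real pi * \<i> * of_real (y \<bullet> \<xi>)) = F \<xi> * of_real (\<Prod>j\<in>{}. \<xi> $ j) * wave y t \<xi>" for \<xi>
  proof (cases "\<xi> \<in> pos_orthant")
    case True
    have "abel_factor t \<xi> = exp (- 2 * pi * (t \<bullet> \<xi>))"
      using pos_orthantD[OF True] by (simp add: abel_factor_def inner_vec_def abs_of_pos)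
    then have "of_real (abel_factor t \<xi>) * exp (2 * of_real pi * \<i> * of_real (y \<bullet> \<xi>)) = wave y t \<xi>"
      unfolding wave_def exp_add by (simp only: exp_of_real)
    then show ?thesis by (simp add: mult.assoc)
  qed (simp add: supp)
  then show ?thesis
    using poisson_integral_eq_fourier[OF assms(1,3), of y] unfolding wave_integral_def assms(2)[symmetric] by (simp only:)
qed

end

text \<open>From \<open>\<bar>t + i d\<bar> \<le> t + \<bar>d\<bar> \<le> sqrt 2 \<bar>t + i
  d\<bar>\<close>; raising \<open>sqrt 2\<close> to the power \<open>2 * l\<close> gives
  \<open>2 powr l\<close>. These are the inequalities that separate the two final constants.\<close>

lemma cone_weight_bounds:
  fixes t d l :: real
  assumes t: "t > 0" and l: "l > 0"
  shows "(t / (t + \<bar>d\<bar>)) powr (2 * l) \<le> (t / cmod (Complex t d)) powr (2 * l)"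
    and "(t / cmod (Complex t d)) powr (2 * l) \<le> 2 powr l * (t / (t + \<bar>d\<bar>)) powr (2 * l)"
proof -
  have c0: "0 < cmod (Complex t d)" using t by (simp add: complex_eq_iff)
  have "cmod (Complex t d) \<le> t + \<bar>d\<bar>" using cmod_le[of "Complex t d"] t by simp
  then show "(t / (t + \<bar>d\<bar>)) powr (2 * l) \<le> (t / cmod (Complex t d)) powr (2 * l)"
    using t l c0 by (intro powr_mono2 divide_left_mono) auto
  have "0 \<le> (t - \<bar>d\<bar>)\<^sup>2" by simp
  then have "(t + \<bar>d\<bar>)\<^sup>2 \<le> 2 * (t\<^sup>2 + d\<^sup>2)" by (simp add: power2_eq_square algebra_simps)
  then have "t + \<bar>d\<bar> \<le> sqrt (2 * (t\<^sup>2 + d\<^sup>2))" by (rule real_le_rsqrt)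
  then have "t + \<bar>d\<bar> \<le> sqrt 2 * cmod (Complex t d)" by (simp only: complex_norm real_sqrt_mult)
  then have "t * (t + \<bar>d\<bar>) \<le> t * (sqrt 2 * cmod (Complex t d))" using t by (intro mult_left_mono) auto
  then have "t / cmod (Complex t d) \<le> sqrt 2 * (t / (t + \<bar>d\<bar>))"
    using t c0 by (simp add: field_simps)
  then have "(t / cmod (Complex t d)) powr (2 * l) \<le> (sqrt 2 * (t / (t + \<bar>d\<bar>))) powr (2 * l)"
    using t l by (intro powr_mono2) auto
  also have "\<dots> = sqrt 2 powr (2 * l) * (t / (t + \<bar>d\<bar>)) powr (2 * l)"
    by (rule powr_mult)
  also have "sqrt 2 powr (2 * l) = (2::real) powr l"
    by (simp add: powr_half_sqrt[symmetric] powr_powr)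
  finally show "(t / cmod (Complex t d)) powr (2 * l) \<le> 2 powr l * (t / (t + \<bar>d\<bar>)) powr (2 * l)" .
qed

lemma g_star_bounds:
  fixes lam x :: "real^'n::{finite,linorder}"
  assumes hs: "half_spectrum F C" and f: "integrable lborel f" and F: "F = fourier f" and lam: "\<And>i. 0 < lam $ i"
  defines "I \<equiv> (\<integral>\<^sup>+p\<in>UNIV \<times> pos_orthant.
      (case p of (y, t) \<Rightarrow>
        ennreal ((\<Prod>i\<in>UNIV. (t $ i / (t $ i + \<bar>x $ i - y $ i\<bar>)) powr ((2 *\<^sub>R lam) $ i))
          * grad_sq (poisson_integral f) (y, t))) \<partial>lborel)"
  defines "N \<equiv> (8 * pi\<^sup>2) ^ CARD('n)"
  defines "M \<equiv> half_spectrum.cone_integral F lam x"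
  shows "I \<le> ennreal N * M" and "ennreal N * M \<le> ennreal (\<Prod>i\<in>UNIV. 2 powr (lam $ i)) * I"
proof -
  interpret half_spectrum F C by fact
  define w where "w y t = (\<Prod>i\<in>UNIV. (t $ i / (t $ i + \<bar>x $ i - y $ i\<bar>)) powr (2 * lam $ i))" for y t
  define r where "r y t = (\<Prod>i\<in>UNIV. (t $ i / cmod (Complex (t $ i) (x $ i - y $ i))) powr (2 * lam $ i))" for y t
  define p2 where "p2 = (\<Prod>i\<in>UNIV. 2 powr (lam $ i))"
  have p20: "p2 \<ge> 0" unfolding p2_def by (intro prod_nonneg) auto
  have N0: "N \<ge> 0" by (simp add: N_def)
  have w0: "w y t \<ge> 0" "r y t \<ge> 0" for y t unfolding w_def r_def by (intro prod_nonneg; simp)+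
  have wr: "w y t \<le> r y t" "r y t \<le> p2 * w y t" if "t \<in> pos_orthant" for y t
    unfolding w_def r_def p2_def prod.distrib[symmetric]
    using cone_weight_bounds[OF pos_orthantD[OF that] lam] by (intro prod_mono conjI; simp)+
  have grad: "grad_sq (poisson_integral f) (y, t) = N * (cmod (wave_integral UNIV y t))\<^sup>2" if "t \<in> pos_orthant" for y t
    unfolding N_def by (rule grad_sq_eq[OF hs poisson_integral_eq_wave_integral[OF f F] that])
  have meas_r [measurable]: "(\<lambda>(y, t). r y t) \<in> borel_measurable (borel \<Otimes>\<^sub>M borel)"
    unfolding r_def complex_norm by simp
  have meas_w [measurable]: "(\<lambda>(y, t). w y t) \<in> borel_measurable (borel \<Otimes>\<^sub>M borel)"
    unfolding w_def by simp
  have I: "I = (\<integral>\<^sup>+(y, t). ennreal (w y t * (N * (cmod (wave_integral UNIV y t))\<^sup>2)) * indicator pos_orthant t \<partial>(lborel \<Otimes>\<^sub>M lborel))"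
    unfolding I_def lborel_prod
  proof (rule nn_integral_cong)
    fix p :: "(real^'n::{finite,linorder}) \<times> (real^'n::{finite,linorder})"
    obtain y t where p: "p = (y, t)" by (cases p)
    show "(case p of (y, t) \<Rightarrow> ennreal ((\<Prod>i\<in>UNIV. (t $ i / (t $ i + \<bar>x $ i - y $ i\<bar>)) powr ((2 *\<^sub>R lam) $ i))
          * grad_sq (poisson_integral f) (y, t))) * indicator (UNIV \<times> pos_orthant) p
        = (case p of (y, t) \<Rightarrow> ennreal (w y t * (N * (cmod (wave_integral UNIV y t))\<^sup>2)) * indicator pos_orthant t)"
      by (cases "t \<in> pos_orthant") (simp_all add: p w_def grad)
  qed
  have "M = (\<integral>\<^sup>+(y, t). ennreal (r y t * (cmod (wave_integral UNIV y t))\<^sup>2) * indicator pos_orthant t \<partial>(lborel \<Otimes>\<^sub>M lborel))"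
    unfolding M_def cone_integral_def lborel_prod
  proof (rule nn_integral_cong)
    fix p :: "(real^'n::{finite,linorder}) \<times> (real^'n::{finite,linorder})"
    obtain y t where p: "p = (y, t)" by (cases p)
    show "(case p of (y, t) \<Rightarrow> ennreal ((\<Prod>i\<in>UNIV. (t $ i / cmod (Complex (t $ i) (x $ i - y $ i))) powr (2 * lam $ i)) * (cmod (wave_integral UNIV y t))\<^sup>2))
          * indicator (UNIV \<times> pos_orthant) p
        = (case p of (y, t) \<Rightarrow> ennreal (r y t * (cmod (wave_integral UNIV y t))\<^sup>2) * indicator pos_orthant t)"
      by (cases "t \<in> pos_orthant") (simp_all add: p r_def)
  qed
  then have "ennreal N * M = (\<integral>\<^sup>+p. ennreal N * (case p of (y, t) \<Rightarrow> ennreal (r y t * (cmod (wave_integral UNIV y t))\<^sup>2) * indicator pos_orthant t) \<partial>(lborel \<Otimes>\<^sub>M lborel))"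
    by (simp add: nn_integral_cmult)
  also have "\<dots> = (\<integral>\<^sup>+(y, t). ennreal (r y t * (N * (cmod (wave_integral UNIV y t))\<^sup>2)) * indicator pos_orthant t \<partial>(lborel \<Otimes>\<^sub>M lborel))"
    using N0 w0 by (intro nn_integral_cong) (auto simp: mult_ac split: split_indicator simp flip: ennreal_mult)
  finally have M: "ennreal N * M = \<dots>" .
  show "I \<le> ennreal N * M" unfolding I M
  proof (rule nn_integral_mono)
    fix p :: "(real^'n::{finite,linorder}) \<times> (real^'n::{finite,linorder})"
    obtain y t where p: "p = (y, t)" by (cases p)
    show "(case p of (y, t) \<Rightarrow> ennreal (w y t * (N * (cmod (wave_integral UNIV y t))\<^sup>2)) * indicator pos_orthant t)
        \<le> (case p of (y, t) \<Rightarrow> ennreal (r y t * (N * (cmod (wave_integral UNIV y t))\<^sup>2)) * indicator pos_orthant t)"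
      using wr(1)[of t y] N0 by (cases "t \<in> pos_orthant") (auto simp: p intro!: ennreal_leI mult_right_mono)
  qed
  have "ennreal N * M \<le> (\<integral>\<^sup>+p. ennreal p2 * (case p of (y, t) \<Rightarrow> ennreal (w y t * (N * (cmod (wave_integral UNIV y t))\<^sup>2)) * indicator pos_orthant t) \<partial>(lborel \<Otimes>\<^sub>M lborel))"
    unfolding M
  proof (rule nn_integral_mono, clarsimp split: split_indicator)
    fix y t :: "real^'n::{finite,linorder}" assume t: "t \<in> pos_orthant"
    have "r y t * (N * (cmod (wave_integral UNIV y t))\<^sup>2) \<le> p2 * w y t * (N * (cmod (wave_integral UNIV y t))\<^sup>2)"
      using wr[OF t] N0 by (intro mult_right_mono) auto
    then show "ennreal (r y t * (N * (cmod (wave_integral UNIV y t))\<^sup>2)) \<le> ennreal p2 * ennreal (w y t * (N * (cmod (wave_integral UNIV y t))\<^sup>2))"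
      using p20 w0 N0 by (simp add: mult.assoc flip: ennreal_mult)
  qed
  also have "\<dots> = ennreal p2 * I" unfolding I by (rule nn_integral_cmult) simp
  finally show "ennreal N * M \<le> ennreal (\<Prod>i\<in>UNIV. 2 powr (lam $ i)) * I" by (simp add: p2_def)
qed

theorem theorem1:
  fixes lam :: "real^'n::{finite,linorder}"
  assumes "\<forall>i. 0 < lam $ i"
  shows "\<exists>A B :: real. 0 < A \<and> 0 < B \<and>
    (\<forall>f \<in> schwartz_space. closure {\<xi>. fourier f \<xi> \<noteq> 0} \<subseteq> D0 \<longrightarrow>
      (\<forall>x.
        ennreal A * g_star (2 *\<^sub>R lam) f x \<le> h_fun lam f x \<and>
        h_fun lam f x \<le> ennreal B * g_star (2 *\<^sub>R lam) f x))"
proof -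
  have lam: "0 < lam $ i" for i using assms by simp
  define k1 where "k1 = kernel_const lam"
  define k2 where "k2 = riesz_const lam"
  define N where "N = (8 * pi\<^sup>2) ^ CARD('n)"
  define p2 where "p2 = (\<Prod>i\<in>UNIV. 2 powr (lam $ i))"
  have pos: "0 < k1" "0 < k2" "0 < N" "0 < p2"
    using weight_const_pos[OF lam] by (auto simp: k1_def k2_def N_def p2_def intro!: prod_pos)
  \<comment> \<open>With \<open>I\<close> and \<open>H\<close> the squares of \<open>g_star\<close>
    and \<open>h_fun\<close> and \<open>M\<close> the cone integral, \<open>k1 * M = k2 * H\<close>
    and \<open>I \<le> N * M \<le> p2 * I\<close>. Hence \<open>a * I \<le> H \<le> b * I\<close>
    with \<open>b = p2 * a\<close>, and the constants for the square functions are
    \<open>sqrt a\<close> and \<open>sqrt b\<close>.\<close>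
  define a where "a = k1 / (N * k2)"
  define b where "b = k1 * p2 / (N * k2)"
  have ab: "0 < a" "0 < b" using pos by (simp_all add: a_def b_def)
  show ?thesis
  proof (rule exI[of _ "sqrt a"], rule exI[of _ "sqrt b"], intro conjI ballI impI allI)
    fix f :: "real^'n::{finite,linorder} \<Rightarrow> complex" and x
    assume f: "f \<in> schwartz_space" and supp: "closure {\<xi>. fourier f \<xi> \<noteq> 0} \<subseteq> D0"
    have int: "integrable lborel f" by (rule schwartz_integrable[OF f])
    interpret half_spectrum "fourier f" "\<integral>x. cmod (f x) \<partial>lborel"
      using zero_outside_pos_orthant[OF continuous_on_fourier[OF int] supp]
      by unfold_locales (auto intro: continuous_on_fourier[OF int] fourier_norm_le)
    define I where "I = (\<integral>\<^sup>+p\<in>UNIV \<times> pos_orthant.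
      (case p of (y, t) \<Rightarrow>
        ennreal ((\<Prod>i\<in>UNIV. (t $ i / (t $ i + \<bar>x $ i - y $ i\<bar>)) powr ((2 *\<^sub>R lam) $ i))
          * grad_sq (poisson_integral f) (y, t))) \<partial>lborel)"
    define H where "H = (\<integral>\<^sup>+R\<in>pos_orthant. ennreal ((cmod (tau lam R f x))\<^sup>2 / (\<Prod>i\<in>UNIV. R $ i)) \<partial>lborel)"
    have g: "g_star (2 *\<^sub>R lam) f x = ennsqrt I" and h: "h_fun lam f x = ennsqrt H"
      by (simp_all only: g_star_def h_fun_def I_def H_def)
    have bnd: "I \<le> ennreal N * cone_integral lam x" "ennreal N * cone_integral lam x \<le> ennreal p2 * I"
      unfolding I_def N_def p2_def
      by (rule g_star_bounds[OF half_spectrum_axioms int refl lam])+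
    have id: "ennreal k1 * cone_integral lam x = ennreal k2 * H"
      using cone_integral_identity[OF lam, of x] by (simp add: k1_def k2_def H_def riesz_mean_def tau_def)
    have H: "H = ennreal (k1 / k2) * cone_integral lam x"
    proof -
      have "H = ennreal (1 / k2) * (ennreal k2 * H)"
        using pos by (simp add: mult.assoc[symmetric] flip: ennreal_mult)
      then show ?thesis unfolding id[symmetric]
        using pos by (simp add: mult.assoc[symmetric] flip: ennreal_mult)
    qed
    have H': "H = ennreal a * (ennreal N * cone_integral lam x)"
      unfolding H using pos by (simp add: a_def mult.assoc[symmetric] flip: ennreal_mult)
    have 1: "ennreal a * I \<le> H" unfolding H' by (intro mult_left_mono bnd) auto
    have "H \<le> ennreal a * (ennreal p2 * I)" unfolding H' by (intro mult_left_mono bnd) auto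
    also have "\<dots> = ennreal b * I"
      using pos ab by (simp add: a_def b_def mult.assoc[symmetric] flip: ennreal_mult)
    finally have 2: "H \<le> ennreal b * I" .
    show "ennreal (sqrt a) * g_star (2 *\<^sub>R lam) f x \<le> h_fun lam f x"
      unfolding g h ennsqrt_cmult[OF ab(1), symmetric] by (rule ennsqrt_mono[OF 1])
    show "h_fun lam f x \<le> ennreal (sqrt b) * g_star (2 *\<^sub>R lam) f x"
      unfolding g h ennsqrt_cmult[OF ab(2), symmetric] by (rule ennsqrt_mono[OF 2])
  qed (use ab in auto)
qed

end
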